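(* Let $\mathcal H$ be a complex Hilbert space and let $\gamma:\mathbb R\to\mathrm{Stand}(\mathcal H)$ be a geodesic with $\gamma(0)=V$ such that the corresponding curve $t\mapsto J_{\gamma(t)}$ (a geodesic in the reflection space $\mathrm{Conj}(\mathcal H)$) is strongly continuous. Then there exists a strongly continuous unitary one-parameter group $(U_t)_{t\in\mathbb R}$ on $\mathcal H$ satisfying $$J_VU_tJ_V=U_{-t}\quad\text{for all }t\in\mathbb R$$ such that $$\gamma(t)=U_{t/2}V\quad\text{for all }t\in\mathbb R.$$ The operators $U_t$ are uniquely determined by the relation $$J_{\gamma(t)}=U_{t/2}J_VU_{t/2}^{-1}=U_tJ_V,\quad\text{resp.,}\quad U_t=J_{\gamma(t)}J_V.$$
   Context: A standard subspace of $\mathcal H$ is a closed real subspace $V$ with $V\cap iV=\{0\}$ and $V+iV$ dense; $\mathrm{Stand}(\mathcal H)$ is the set of these. The closed antilinear operator $S(v+iw)=v-iw$ on $V+iV$ has polar decomposition $S=J_V\Delta_V^{1/2}$, where $\Delta_V=S^*S$ and $J_V$ is an antiunitary involution. A reflection space is a set $M$ with a product $\bullet$ such that, for $s_x(y)=x\bullet y$, one has $s_x(x)=x$, $s_x^2=\mathrm{id}_M$ and $s_x(y\bullet z)=s_x(y)\bullet s_x(z)$. $\mathrm{Stand}(\mathcal H)$ is a reflection space with $V_1\bullet V_2=J_{V_1}J_{V_2}V_2$; the set $\mathrm{Conj}(\mathcal H)$ of antiunitary involutions on $\mathcal H$ is a reflection space with $J_1\bullet J_2=J_1J_2J_1$,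 equipped with the strong operator topology. A geodesic in $\mathrm{Stand}(\mathcal H)$ is a map $\gamma:\mathbb R\to\mathrm{Stand}(\mathcal H)$ with $\gamma(2t-s)=\gamma(t)\bullet\gamma(s)$ for all $s,t\in\mathbb R$ (i.e. a morphism of reflection spaces, where $\mathbb R$ carries $t\bullet s=2t-s$). *)

theory Defs
  imports "HOL-Analysis.Analysis"
begin

text \<open>
  The inner product is linear in the second argument. Its positive definiteness is contained in
  the last axiom, since norms are nonnegative and \<open>sqrt\<close> is odd.
\<close>

class complex_hilbert_space = banach +
  fixes scaleC :: "complex \<Rightarrow> 'a \<Rightarrow> 'a" (infixr "*\<^sub>C" 75)
    and cinner :: "'a \<Rightarrow> 'a \<Rightarrow> complex"
  assumes scaleC_add_right: "c *\<^sub>C (x + y) = c *\<^sub>C x + c *\<^sub>C y"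
    and scaleC_add_left: "(c + d) *\<^sub>C x = c *\<^sub>C x + d *\<^sub>C x"
    and scaleC_scaleC: "c *\<^sub>C d *\<^sub>C x = (c * d) *\<^sub>C x"
    and scaleC_of_real: "complex_of_real r *\<^sub>C x = r *\<^sub>R x"
    and cinner_commute: "cinner x y = cnj (cinner y x)"
    and cinner_add_right: "cinner x (y + z) = cinner x y + cinner x z"
    and cinner_scaleC_right: "cinner x (c *\<^sub>C y) = c * cinner x y"
    and norm_eq_sqrt_cinner: "norm x = sqrt (Re (cinner x x))"

definition unitary_op :: "('a::complex_hilbert_space \<Rightarrow> 'a) \<Rightarrow> bool" where
  "unitary_op f \<longleftrightarrow>
     (\<forall>x y. f (x + y) = f x + f y) \<and> (\<forall>c x. f (c *\<^sub>C x) = c *\<^sub>C f x) \<and>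
     (\<forall>x y. cinner (f x) (f y) = cinner x y) \<and> surj f"

definition antiunitary_op :: "('a::complex_hilbert_space \<Rightarrow> 'a) \<Rightarrow> bool" where
  "antiunitary_op f \<longleftrightarrow>
     (\<forall>x y. f (x + y) = f x + f y) \<and> (\<forall>c x. f (c *\<^sub>C x) = cnj c *\<^sub>C f x) \<and>
     (\<forall>x y. cinner (f x) (f y) = cnj (cinner x y)) \<and> surj f"

definition strongly_continuous ::
    "(real \<Rightarrow> 'a::complex_hilbert_space \<Rightarrow> 'a) \<Rightarrow> bool" where
  "strongly_continuous F \<longleftrightarrow> (\<forall>x. continuous_on UNIV (\<lambda>t. F t x))"

definition unitary_one_parameter_group ::
    "(real \<Rightarrow> 'a::complex_hilbert_space \<Rightarrow> 'a) \<Rightarrow> bool" where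
  "unitary_one_parameter_group U \<longleftrightarrow>
     (\<forall>t. unitary_op (U t)) \<and> U 0 = id \<and> (\<forall>s t. U (s + t) = U s \<circ> U t)"

text \<open>
  Unbounded (linear or antilinear) operators are represented by their graphs, so that equality of
  operators includes equality of domains. Composition is relational composition, in which the
  left factor acts first: \<open>A O B\<close> is the operator product $BA$ on its maximal domain.
\<close>

definition linear_adjoint :: "('a::complex_hilbert_space \<times> 'a) set \<Rightarrow> ('a \<times> 'a) set" where
  "linear_adjoint T = {(y, z). \<forall>(x, x') \<in> T. cinner y x' = cinner z x}"

text \<open>For antilinear $S$ the defining relation is $\langle y, Sx\rangle = \langle x, S^*y\rangle$.\<close>

definition antilinear_adjoint :: "('a::complex_hilbert_space \<times> 'a) set \<Rightarrow> ('a \<times> 'a) set" where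
  "antilinear_adjoint S = {(y, z). \<forall>(x, x') \<in> S. cinner y x' = cinner x z}"

text \<open>
  The condition \<open>linear_adjoint T = T\<close> forces \<open>T\<close> to be a complex subspace, and together with the
  dense domain it makes \<open>T\<close> single-valued, i.e. the graph of a linear operator.
\<close>

definition positive_selfadjoint :: "('a::complex_hilbert_space \<times> 'a) set \<Rightarrow> bool" where
  "positive_selfadjoint T \<longleftrightarrow>
     closure (Domain T) = UNIV \<and> linear_adjoint T = T \<and>
     (\<forall>(x, y) \<in> T. cinner x y \<in> nonneg_Reals)"

definition positive_sqrt :: "('a::complex_hilbert_space \<times> 'a) set \<Rightarrow> ('a \<times> 'a) set" where
  "positive_sqrt A = (THE T. positive_selfadjoint T \<and> T O T = A)"

definition standard_subspace :: "'a::complex_hilbert_space set \<Rightarrow> bool" where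
  "standard_subspace V \<longleftrightarrow>
     closed V \<and> subspace V \<and> V \<inter> (\<lambda>v. \<i> *\<^sub>C v) ` V = {0} \<and>
     closure {v + \<i> *\<^sub>C w | v w. v \<in> V \<and> w \<in> V} = UNIV"

definition Stand :: "'a::complex_hilbert_space set set" where
  "Stand = {V. standard_subspace V}"

definition tomita_op :: "'a::complex_hilbert_space set \<Rightarrow> ('a \<times> 'a) set" where
  "tomita_op V = {(v + \<i> *\<^sub>C w, v - \<i> *\<^sub>C w) | v w. v \<in> V \<and> w \<in> V}"

definition modular_op :: "'a::complex_hilbert_space set \<Rightarrow> ('a \<times> 'a) set" where
  "modular_op V = tomita_op V O antilinear_adjoint (tomita_op V)"

text \<open>The antiunitary factor $J_V$ of the polar decomposition $S = J_V \Delta_V^{1/2}$.\<close>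

definition modular_conj :: "'a::complex_hilbert_space set \<Rightarrow> 'a \<Rightarrow> 'a" where
  "modular_conj V =
     (THE J. antiunitary_op J \<and> tomita_op V = positive_sqrt (modular_op V) O {(x, J x) | x. True})"

definition stand_prod ::
    "'a::complex_hilbert_space set \<Rightarrow> 'a set \<Rightarrow> 'a set" (infixl "\<bullet>\<^sub>S" 70) where
  "V \<bullet>\<^sub>S W = (modular_conj V \<circ> modular_conj W) ` W"

definition stand_geodesic :: "(real \<Rightarrow> 'a::complex_hilbert_space set) \<Rightarrow> bool" where
  "stand_geodesic \<gamma> \<longleftrightarrow>
     (\<forall>t. \<gamma> t \<in> Stand) \<and> (\<forall>s t. \<gamma> (2 * t - s) = \<gamma> t \<bullet>\<^sub>S \<gamma> s)"

end

theory Submission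
  imports Defs
begin

text \<open>
  Write \<open>J\<^sub>t\<close> for the modular conjugation of \<open>\<gamma> t\<close>. Everything follows from two properties of
  modular conjugations: each is an antiunitary involution (\<open>antiunitary_modular_conj\<close>,
  \<open>modular_conj_involution\<close>), and a unitary \<open>g\<close> carries the one of \<open>V\<close> to the one of \<open>gV\<close> by
  conjugation (\<open>modular_conj_unitary_image\<close>). Since \<open>J\<^sub>t J\<^sub>s\<close> is unitary and maps \<open>\<gamma> s\<close> to
  \<open>\<gamma> (2 * t - s)\<close>, the second property gives \<open>J\<^bsub>2t-s\<^esub> = J\<^sub>t J\<^sub>s J\<^sub>t\<close>. For \<open>U\<^sub>t = J\<^sub>t J\<^sub>0\<close> this identity
  yields the group law on every cyclic subgroup of the reals, hence on the rationals, and strong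
  continuity extends it to all reals (\<open>reflection_geodesic_add\<close>). The remaining relations are
  short computations with involutions. If a group \<open>W\<close> also describes \<open>\<gamma>\<close> and is inverted by \<open>J\<^sub>0\<close>, then conjugating with
  \<open>W\<^bsub>t/2\<^esub>\<close> gives \<open>J\<^sub>t = W\<^bsub>t/2\<^esub> J\<^sub>0 W\<^bsub>-t/2\<^esub> = W\<^sub>t J\<^sub>0\<close>, so \<open>W = U\<close>.

  The two properties need the polar decomposition of the unbounded operator \<open>S\<close> of \<open>V\<close>. It is
  obtained from bounded operators on the underlying real Hilbert space. Let \<open>P\<close> and \<open>Q\<close> be the
  real orthogonal projections onto \<open>V\<close> and \<open>iV\<close>, \<open>B = (P + Q) / 2\<close> and \<open>K = (P - Q) / 2\<close>. Then
  \<open>B\<close> is complex linear with \<open>0 \<le> B \<le> 1\<close>, \<open>K\<close> is antilinear, \<open>K B = (1 - B) K\<close> and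
  \<open>K\<^sup>2 = B (1 - B)\<close>, and \<open>\<Delta>\<close> has the graph \<open>{(B w, (1 - B) w)}\<close>. With the positive square roots \<open>c\<close>
  of \<open>B\<close> and \<open>s\<close> of \<open>1 - B\<close>, the graph of \<open>\<Delta>\<^bsup>1/2\<^esup>\<close> is \<open>{(c x, s x)}\<close>, and \<open>J\<close> is the isometry with
  \<open>J c s = K\<close>. Square roots are norm limits of polynomials, so they inherit every intertwining
  relation (\<open>op_sqrt_intertwines\<close>): this gives \<open>J c = s J\<close> and \<open>J\<^sup>2 = 1\<close> from \<open>K B = (1 - B) K\<close>, and
  the unitary covariance of \<open>J\<close> from that of \<open>P\<close> and \<open>Q\<close>.
\<close>

section \<open>Square roots of bounded operators\<close>

text \<open>
  If \<open>Y\<close> is a fixed point of the iteration \<open>Y \<mapsto> (C + Y\<^sup>2) / 2\<close>, then \<open>(1 - Y)\<^sup>2 = 1 - C\<close>. Square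
  roots of \<open>1 - C\<close> are therefore obtained as \<open>1 - Y\<close>.
\<close>

primrec sqrt_iter :: "('a::real_normed_vector \<Rightarrow>\<^sub>L 'a) \<Rightarrow> nat \<Rightarrow> 'a \<Rightarrow>\<^sub>L 'a" where
  "sqrt_iter C 0 = 0"
| "sqrt_iter C (Suc n) = (1/2) *\<^sub>R (C + (sqrt_iter C n o\<^sub>L sqrt_iter C n))"

text \<open>
  The case \<open>C = 1\<close> of the iteration for scalars; it majorizes the norms of the iterates and of their
  increments whenever \<open>norm C \<le> 1\<close>.
\<close>

primrec scalar_sqrt_iter :: "nat \<Rightarrow> real" where
  "scalar_sqrt_iter 0 = 0"
| "scalar_sqrt_iter (Suc n) = (1 + (scalar_sqrt_iter n)\<^sup>2) / 2"

lemma scalar_sqrt_iter_bounds: "0 \<le> scalar_sqrt_iter n \<and> scalar_sqrt_iter n \<le> 1"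
  by (induction n) (auto simp: power_le_one)

lemma scalar_sqrt_iter_mono: "scalar_sqrt_iter n \<le> scalar_sqrt_iter (Suc n)"
  using sum_squares_bound[of "scalar_sqrt_iter n" 1] by simp

lemma sqrt_iter_intertwines:
  fixes C1 :: "'a::real_normed_vector \<Rightarrow>\<^sub>L 'a" and C2 :: "'b::real_normed_vector \<Rightarrow>\<^sub>L 'b"
    and D :: "'a \<Rightarrow>\<^sub>L 'b"
  assumes "\<And>x. D (C1 x) = C2 (D x)"
  shows "D (sqrt_iter C1 n x) = sqrt_iter C2 n (D x)"
  by (induction n arbitrary: x) (simp_all add: blinfun.bilinear_simps assms)

lemma norm_sqrt_iter:
  fixes C :: "'a::real_normed_vector \<Rightarrow>\<^sub>L 'a"
  assumes "norm C \<le> 1"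
  shows "norm (sqrt_iter C n) \<le> scalar_sqrt_iter n"
proof (induction n)
  case (Suc n)
  have "norm (sqrt_iter C n o\<^sub>L sqrt_iter C n) \<le> norm (sqrt_iter C n) * norm (sqrt_iter C n)"
    by (rule norm_blinfun_compose)
  also have "\<dots> \<le> scalar_sqrt_iter n * scalar_sqrt_iter n"
    using Suc by (intro mult_mono) (auto simp: scalar_sqrt_iter_bounds)
  finally show ?case
    using assms norm_triangle_ineq[of C "sqrt_iter C n o\<^sub>L sqrt_iter C n"]
    by (simp add: power2_eq_square)
qed simp

text \<open>
  The iterates are polynomials in \<open>C\<close> and commute, so consecutive increments satisfy
  \<open>Y'' - Y' = (Y' - Y) (Y' + Y) / 2\<close>; the scalar iteration satisfies the same identity.
\<close>

lemma norm_sqrt_iter_diff: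
  fixes C :: "'a::real_normed_vector \<Rightarrow>\<^sub>L 'a"
  assumes "norm C \<le> 1"
  shows "norm (sqrt_iter C (Suc n) - sqrt_iter C n) \<le> scalar_sqrt_iter (Suc n) - scalar_sqrt_iter n"
proof (induction n)
  case 0
  then show ?case using assms by simp
next
  case (Suc n)
  define Y Y' where "Y = sqrt_iter C n" and "Y' = sqrt_iter C (Suc n)"
  define y y' where "y = scalar_sqrt_iter n" and "y' = scalar_sqrt_iter (Suc n)"
  have "C (Y x) = Y (C x)" for x
    unfolding Y_def by (rule sqrt_iter_intertwines) simp
  hence comm: "Y (Y' x) = Y' (Y x)" for x
    unfolding Y'_def by (intro sqrt_iter_intertwines) metis
  have "sqrt_iter C (Suc (Suc n)) - Y' = (1/2) *\<^sub>R ((Y' - Y) o\<^sub>L (Y' + Y))"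
  proof (rule blinfun_eqI)
    fix x
    have 1: "sqrt_iter C (Suc (Suc n)) x = (1/2) *\<^sub>R (C x + Y' (Y' x))"
      by (simp add: Y'_def blinfun.bilinear_simps)
    have 2: "Y' x = (1/2) *\<^sub>R (C x + Y (Y x))"
      by (simp add: Y'_def Y_def blinfun.bilinear_simps)
    have "(sqrt_iter C (Suc (Suc n)) - Y') x = (1/2) *\<^sub>R (C x + Y' (Y' x)) - (1/2) *\<^sub>R (C x + Y (Y x))"
      by (simp only: blinfun.diff_left 1 2[symmetric])
    also have "\<dots> = ((1/2) *\<^sub>R ((Y' - Y) o\<^sub>L (Y' + Y))) x"
      by (simp add: blinfun.bilinear_simps comm algebra_simps)
    finally show "(sqrt_iter C (Suc (Suc n)) - Y') x = ((1/2) *\<^sub>R ((Y' - Y) o\<^sub>L (Y' + Y))) x" .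
  qed
  hence "norm (sqrt_iter C (Suc (Suc n)) - Y') = (1/2) * norm ((Y' - Y) o\<^sub>L (Y' + Y))"
    by simp
  also have "\<dots> \<le> (1/2) * (norm (Y' - Y) * norm (Y' + Y))"
    using norm_blinfun_compose by simp
  also have "\<dots> \<le> (1/2) * ((y' - y) * (y' + y))"
  proof -
    have "norm (Y' + Y) \<le> y' + y"
      using norm_triangle_ineq[of Y' Y] norm_sqrt_iter[OF assms, of n]
        norm_sqrt_iter[OF assms, of "Suc n"]
      unfolding Y_def Y'_def y_def y'_def by linarith
    moreover have "norm (Y' - Y) \<le> y' - y"
      using Suc unfolding Y_def Y'_def y_def y'_def .
    ultimately have "norm (Y' - Y) * norm (Y' + Y) \<le> (y' - y) * (y' + y)"
      by (intro mult_mono) (use scalar_sqrt_iter_mono[of n] in \<open>auto simp: y_def y'_def\<close>)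
    thus ?thesis by simp
  qed
  also have "\<dots> = (y'\<^sup>2 - y\<^sup>2) / 2"
    by (simp add: power2_eq_square algebra_simps)
  also have "\<dots> = scalar_sqrt_iter (Suc (Suc n)) - y'"
    unfolding y_def y'_def by (simp add: field_simps)
  finally show ?case unfolding Y'_def y'_def .
qed

text \<open>
  The scalar iteration is increasing and bounded by 1, so its increments form a summable majorant.
\<close>

lemma sqrt_iter_convergent:
  fixes C :: "'a::banach \<Rightarrow>\<^sub>L 'a"
  assumes "norm C \<le> 1"
  shows "convergent (sqrt_iter C)"
proof -
  have "incseq scalar_sqrt_iter"
    by (rule incseq_SucI) (rule scalar_sqrt_iter_mono)
  then obtain l where "scalar_sqrt_iter \<longlonglongrightarrow> l"
    using incseq_convergent[of scalar_sqrt_iter 1] scalar_sqrt_iter_bounds by blast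
  hence "summable (\<lambda>n. scalar_sqrt_iter (Suc n) - scalar_sqrt_iter n)"
    by (rule telescope_summable)
  hence "summable (\<lambda>n. sqrt_iter C (Suc n) - sqrt_iter C n)"
    using norm_sqrt_iter_diff[OF assms] by (rule summable_comparison_test'[where N = 0])
  hence "convergent (\<lambda>n. \<Sum>k<n. sqrt_iter C (Suc k) - sqrt_iter C k)"
    using summable_iff_convergent by blast
  thus ?thesis
    by (simp only: sum_lessThan_telescope) simp
qed

definition op_sqrt :: "('a::banach \<Rightarrow>\<^sub>L 'a) \<Rightarrow> 'a \<Rightarrow>\<^sub>L 'a" where
  "op_sqrt A = id_blinfun - lim (sqrt_iter (id_blinfun - A))"

context
  fixes A :: "'a::banach \<Rightarrow>\<^sub>L 'a"
  assumes near_id: "norm (id_blinfun - A) \<le> 1"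
begin

lemma op_sqrt_limit: "sqrt_iter (id_blinfun - A) \<longlonglongrightarrow> id_blinfun - op_sqrt A"
  using sqrt_iter_convergent[OF near_id] by (simp add: op_sqrt_def convergent_LIMSEQ_iff)

lemma op_sqrt_limit_apply:
  "(\<lambda>n. sqrt_iter (id_blinfun - A) n x) \<longlonglongrightarrow> x - op_sqrt A x"
  using blinfun.tendsto[OF op_sqrt_limit tendsto_const, of x]
  by (simp add: blinfun.bilinear_simps)

lemma op_sqrt_near_id: "norm (id_blinfun - op_sqrt A) \<le> 1"
proof (rule LIMSEQ_le_const2[OF tendsto_norm[OF op_sqrt_limit]])
  show "\<exists>N. \<forall>n\<ge>N. norm (sqrt_iter (id_blinfun - A) n) \<le> 1"
    using norm_sqrt_iter[OF near_id] scalar_sqrt_iter_bounds by (meson order_trans)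
qed

lemma op_sqrt_square: "op_sqrt A (op_sqrt A x) = A x"
proof -
  let ?C = "id_blinfun - A" and ?Y = "id_blinfun - op_sqrt A"
  have "(\<lambda>n. (1/2) *\<^sub>R (?C + (sqrt_iter ?C n o\<^sub>L sqrt_iter ?C n))) \<longlonglongrightarrow> (1/2) *\<^sub>R (?C + (?Y o\<^sub>L ?Y))"
    by (intro tendsto_intros bounded_bilinear.tendsto[OF bounded_bilinear_blinfun_compose] op_sqrt_limit)
  moreover have "(\<lambda>n. sqrt_iter ?C (Suc n)) \<longlonglongrightarrow> ?Y"
    using op_sqrt_limit by (rule LIMSEQ_Suc)
  ultimately have "(1/2) *\<^sub>R (?C + (?Y o\<^sub>L ?Y)) = ?Y"
    using LIMSEQ_unique by auto
  hence "2 *\<^sub>R ((1/2) *\<^sub>R (?C + (?Y o\<^sub>L ?Y))) = 2 *\<^sub>R ?Y" by (rule arg_cong)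
  hence "?C + (?Y o\<^sub>L ?Y) = 2 *\<^sub>R ?Y" by simp
  hence "(?C + (?Y o\<^sub>L ?Y)) x = (2 *\<^sub>R ?Y) x" by (rule arg_cong)
  thus ?thesis
    by (simp add: blinfun.bilinear_simps scaleR_2 algebra_simps)
qed

end

text \<open>
  This replaces the functional calculus in what follows: it transports both commutation relations
  (\<open>A1 = A2\<close>) and covariance under a change of space from operators to their square roots.
\<close>

lemma op_sqrt_intertwines:
  fixes A1 :: "'a::banach \<Rightarrow>\<^sub>L 'a" and A2 :: "'b::banach \<Rightarrow>\<^sub>L 'b"
    and D :: "'a \<Rightarrow>\<^sub>L 'b"
  assumes "norm (id_blinfun - A1) \<le> 1" "norm (id_blinfun - A2) \<le> 1"
    and DA: "\<And>x. D (A1 x) = A2 (D x)"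
  shows "D (op_sqrt A1 x) = op_sqrt A2 (D x)"
proof -
  have "D (sqrt_iter (id_blinfun - A1) n x) = sqrt_iter (id_blinfun - A2) n (D x)" for n
    by (rule sqrt_iter_intertwines) (simp add: blinfun.bilinear_simps DA)
  moreover have "(\<lambda>n. D (sqrt_iter (id_blinfun - A1) n x)) \<longlonglongrightarrow> D (x - op_sqrt A1 x)"
    by (intro tendsto_intros op_sqrt_limit_apply assms)
  ultimately have "D (x - op_sqrt A1 x) = D x - op_sqrt A2 (D x)"
    using op_sqrt_limit_apply[OF assms(2), of "D x"] LIMSEQ_unique by auto
  thus ?thesis by (simp add: blinfun.bilinear_simps)
qed

section \<open>The underlying real Hilbert space\<close>

definition rinner :: "'a::complex_hilbert_space \<Rightarrow> 'a \<Rightarrow> real" where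
  "rinner x y = Re (cinner x y)"

lemma cinner_add_left: "cinner (x + y) z = cinner x z + cinner y z"
  for x :: "'a::complex_hilbert_space"
  using cinner_add_right[of z x y] cinner_commute[of _ z] cinner_commute[of z]
  by (metis complex_cnj_add)

lemma cinner_scaleC_left: "cinner (c *\<^sub>C x) y = cnj c * cinner x y"
  for x :: "'a::complex_hilbert_space"
  by (metis cinner_commute cinner_scaleC_right complex_cnj_mult)

lemma rinner_commute: "rinner x y = rinner y x"
  unfolding rinner_def by (subst cinner_commute) simp

lemma rinner_add_right: "rinner x (y + z) = rinner x y + rinner x z"
  by (simp add: rinner_def cinner_add_right)

lemma rinner_add_left: "rinner (x + y) z = rinner x z + rinner y z"
  by (simp add: rinner_def cinner_add_left)

lemma rinner_scaleR_right: "rinner x (r *\<^sub>R y) = r * rinner x y"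
  unfolding rinner_def scaleC_of_real[symmetric] cinner_scaleC_right by simp

lemma rinner_self: "rinner x x = (norm x)\<^sup>2"
proof -
  have "0 \<le> rinner x x"
    using norm_ge_zero[of x] unfolding norm_eq_sqrt_cinner rinner_def by simp
  thus ?thesis by (simp add: norm_eq_sqrt_cinner rinner_def)
qed

text \<open>
  The Cauchy-Schwarz inequality is the triangle inequality for \<open>x + y\<close>, squared.
\<close>

lemma rinner_le_norm: "rinner x y \<le> norm x * norm y"
proof -
  have "(norm (x + y))\<^sup>2 \<le> (norm x + norm y)\<^sup>2"
    by (intro power_mono norm_triangle_ineq) simp
  moreover have "(norm (x + y))\<^sup>2 = (norm x)\<^sup>2 + 2 * rinner x y + (norm y)\<^sup>2"
    using rinner_commute[of x y]
    by (simp add: rinner_self[symmetric] rinner_add_right rinner_add_left)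
  ultimately show ?thesis by (simp add: power2_sum)
qed

lemma bounded_bilinear_rinner: "bounded_bilinear (rinner :: 'a::complex_hilbert_space \<Rightarrow> 'a \<Rightarrow> real)"
proof
  show "\<exists>K. \<forall>a b :: 'a. norm (rinner a b) \<le> norm a * norm b * K"
  proof (intro exI[of _ 1] allI)
    fix a b :: 'a
    have "- rinner a b = rinner a ((-1) *\<^sub>R b)" by (simp only: rinner_scaleR_right)
    hence "- rinner a b \<le> norm a * norm b" using rinner_le_norm[of a "(-1) *\<^sub>R b"] by simp
    thus "norm (rinner a b) \<le> norm a * norm b * 1" using rinner_le_norm[of a b] by simp
  qed
  show "rinner (r *\<^sub>R a) b = r *\<^sub>R rinner a b" for r and a b :: 'a
    by (metis rinner_commute rinner_scaleR_right real_scaleR_def)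
qed (simp_all add: rinner_add_right rinner_add_left rinner_scaleR_right)

interpretation rinner: bounded_bilinear "rinner :: 'a::complex_hilbert_space \<Rightarrow> 'a \<Rightarrow> real"
  by (rule bounded_bilinear_rinner)

lemmas rinner_simps = rinner.add_left rinner.add_right rinner.diff_left rinner.diff_right
  rinner.minus_left rinner.minus_right rinner.scaleR_left rinner.scaleR_right
  rinner.zero_left rinner.zero_right

lemma rinner_eq_0_all: "(\<And>y. rinner x y = 0) \<Longrightarrow> x = 0"
  by (metis rinner_self norm_eq_zero power_eq_0_iff)

lemma scaleC_ii_ii [simp]: "\<i> *\<^sub>C \<i> *\<^sub>C x = - x"
  for x :: "'a::complex_hilbert_space"
  using scaleC_of_real[of "-1" x] by (simp add: scaleC_scaleC)

lemma rinner_ii_ii [simp]: "rinner (\<i> *\<^sub>C x) (\<i> *\<^sub>C y) = rinner x y"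
  by (simp add: rinner_def cinner_scaleC_left cinner_scaleC_right)

lemma cinner_rinner: "cinner x y = Complex (rinner x y) (rinner (\<i> *\<^sub>C x) y)"
  by (simp add: rinner_def cinner_scaleC_left complex_eq_iff)

lemma scaleC_rinner: "c *\<^sub>C x = Re c *\<^sub>R x + Im c *\<^sub>R (\<i> *\<^sub>C x)"
  for x :: "'a::complex_hilbert_space"
  by (metis complex_eq mult.commute scaleC_add_left scaleC_of_real scaleC_scaleC)

lemma norm_ii [simp]: "norm (\<i> *\<^sub>C x) = norm x"
  for x :: "'a::complex_hilbert_space"
  using rinner_ii_ii[of x x] by (simp add: rinner_self)

lemma bounded_linear_ii: "bounded_linear (\<lambda>x::'a::complex_hilbert_space. \<i> *\<^sub>C x)"
proof (rule bounded_linear_intro[where K = 1])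
  fix r :: real and x y :: 'a
  show "\<i> *\<^sub>C (x + y) = \<i> *\<^sub>C x + \<i> *\<^sub>C y" by (rule scaleC_add_right)
  show "\<i> *\<^sub>C r *\<^sub>R x = r *\<^sub>R \<i> *\<^sub>C x"
    by (simp only: scaleC_of_real[symmetric] scaleC_scaleC mult.commute)
qed simp

lemmas ii_simps = linear_add[OF bounded_linear.linear[OF bounded_linear_ii]]
  linear_diff[OF bounded_linear.linear[OF bounded_linear_ii]]
  linear_neg[OF bounded_linear.linear[OF bounded_linear_ii]]
  linear_scale[OF bounded_linear.linear[OF bounded_linear_ii]]
  linear_0[OF bounded_linear.linear[OF bounded_linear_ii]]

lemma norm_diff_square: "(norm (x - y))\<^sup>2 = (norm x)\<^sup>2 - 2 * rinner x y + (norm y)\<^sup>2"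
  by (simp add: rinner_self[symmetric] rinner_simps rinner_commute[of y x])

lemma parallelogram:
  fixes x y :: "'a::complex_hilbert_space"
  shows "(norm (x + y))\<^sup>2 + (norm (x - y))\<^sup>2 = 2 * (norm x)\<^sup>2 + 2 * (norm y)\<^sup>2"
  by (simp add: rinner_self[symmetric] rinner_simps)

text \<open>
  By the parallelogram law a sequence in \<open>V\<close> that minimizes the distance to \<open>x\<close> is Cauchy; moving its
  limit inside \<open>V\<close> along \<open>v\<close> cannot decrease the distance, which forces orthogonality.
\<close>

lemma orthogonal_projection_exists:
  fixes V :: "'a::complex_hilbert_space set"
  assumes "closed V" "subspace V"
  obtains y where "y \<in> V" "\<And>v. v \<in> V \<Longrightarrow> rinner (x - y) v = 0"
proof -
  define d where "d = Inf ((\<lambda>v. (norm (x - v))\<^sup>2) ` V)"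
  have V0: "0 \<in> V" using assms(2) by (rule subspace_0)
  have bdd: "bdd_below ((\<lambda>v. (norm (x - v))\<^sup>2) ` V)"
    by (rule bdd_belowI[of _ 0]) auto
  have d_le: "d \<le> (norm (x - v))\<^sup>2" if "v \<in> V" for v
    unfolding d_def using that bdd by (intro cInf_lower) auto
  have "\<exists>v\<in>V. (norm (x - v))\<^sup>2 < d + 1 / (n + 1)" for n :: nat
  proof -
    have "d < d + 1 / (n + 1)" by simp
    thus ?thesis unfolding d_def using V0 cInf_lessD by (metis (no_types, lifting) empty_iff imageE image_is_empty)
  qed
  then obtain u :: "nat \<Rightarrow> 'a" where
    u: "\<And>n. u n \<in> V" "\<And>n. (norm (x - u n))\<^sup>2 < d + 1 / (real n + 1)"
    by (metis of_nat_1 of_nat_add)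
  have diff: "(norm (u m - u n))\<^sup>2 \<le> 2 / (m + 1) + 2 / (n + 1)" for m n
  proof -
    have "(1/2) *\<^sub>R (u m + u n) \<in> V" using u(1) assms(2) by (simp add: subspace_add subspace_scale)
    hence "d \<le> (norm (x - (1/2) *\<^sub>R (u m + u n)))\<^sup>2" by (rule d_le)
    also have "\<dots> = (norm ((1/2) *\<^sub>R ((x - u m) + (x - u n))))\<^sup>2"
      by (rule arg_cong[where f = "\<lambda>z. (norm z)\<^sup>2"])
        (simp add: algebra_simps flip: scaleR_add_left)
    also have "\<dots> = (norm ((x - u m) + (x - u n)))\<^sup>2 / 4"
      by (simp add: power_divide)
    finally have "4 * d \<le> (norm ((x - u m) + (x - u n)))\<^sup>2" by simp
    moreover have "(norm (u m - u n))\<^sup>2 = (norm ((x - u m) - (x - u n)))\<^sup>2"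
      by (simp add: norm_minus_commute)
    ultimately show ?thesis
      using parallelogram[of "x - u m" "x - u n"] u(2)[of m] u(2)[of n] by simp
  qed
  have "Cauchy u"
  proof (rule metric_CauchyI)
    fix e :: real assume "0 < e"
    then obtain N :: nat where N: "4 / e\<^sup>2 < N" using reals_Archimedean2 by blast
    have "norm (u m - u n) < e" if "m \<ge> N" "n \<ge> N" for m n
    proof -
      have N0: "0 < real N" using N \<open>0 < e\<close> by (smt (verit) divide_pos_pos zero_less_power)
      have "2 / (real m + 1) < 2 / real N" "2 / (real n + 1) < 2 / real N"
        using that N0 by (auto intro!: divide_strict_left_mono)
      hence "(norm (u m - u n))\<^sup>2 < 2 / real N + 2 / real N" using diff[of m n] by linarith
      also have "\<dots> = 4 / real N" by simp
      also have "\<dots> < e\<^sup>2" using N N0 \<open>0 < e\<close> by (simp add: field_simps)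
      finally show ?thesis using \<open>0 < e\<close> by (simp add: power_less_imp_less_base)
    qed
    thus "\<exists>N. \<forall>m\<ge>N. \<forall>n\<ge>N. dist (u m) (u n) < e" unfolding dist_norm by blast
  qed
  then obtain y where y: "u \<longlonglongrightarrow> y" using Cauchy_convergent convergent_def by blast
  have yV: "y \<in> V" using assms(1) u(1) y by (meson closed_sequential_limits)
  have lim_d: "(\<lambda>n. d + 1 / (real n + 1)) \<longlonglongrightarrow> d"
    using LIMSEQ_inverse_real_of_nat_add[of d] by (simp add: inverse_eq_divide add.commute)
  have lim_norm: "(\<lambda>n. (norm (x - u n))\<^sup>2) \<longlonglongrightarrow> (norm (x - y))\<^sup>2"
    by (intro tendsto_intros y)
  have le_d: "(norm (x - y))\<^sup>2 \<le> d"
    by (rule LIMSEQ_le[OF lim_norm lim_d]) (use u(2) in \<open>auto intro: less_imp_le\<close>)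
  have "rinner (x - y) v = 0" if "v \<in> V" for v
  proof (rule ccontr)
    define r where "r = rinner (x - y) v"
    assume "rinner (x - y) v \<noteq> 0"
    hence r: "r \<noteq> 0" and v: "v \<noteq> 0" by (auto simp: r_def rinner_simps)
    \<comment> \<open>the step length at which the distance along \<open>v\<close> is minimal\<close>
    define t where "t = r / (norm v)\<^sup>2"
    have "y + t *\<^sub>R v \<in> V" using yV that assms(2) by (simp add: subspace_add subspace_scale)
    from order_trans[OF le_d d_le[OF this]]
    have "(norm (x - y))\<^sup>2 \<le> (norm (x - (y + t *\<^sub>R v)))\<^sup>2" .
    also have "\<dots> = (norm (x - y))\<^sup>2 - 2 * t * r + t\<^sup>2 * (norm v)\<^sup>2"
      using norm_diff_square[of "x - y" "t *\<^sub>R v"]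
      by (simp add: diff_diff_add r_def rinner.scaleR_right power_mult_distrib)
    also have "\<dots> = (norm (x - y))\<^sup>2 - r\<^sup>2 / (norm v)\<^sup>2"
      using v by (simp add: t_def power2_eq_square)
    finally show False using r v by (simp add: divide_le_0_iff)
  qed
  thus thesis using yV that by blast
qed

definition rproj :: "'a::complex_hilbert_space set \<Rightarrow> 'a \<Rightarrow>\<^sub>L 'a" where
  "rproj V = Blinfun (\<lambda>x. SOME y. y \<in> V \<and> (\<forall>v\<in>V. rinner (x - y) v = 0))"

context
  fixes V :: "'a::complex_hilbert_space set"
  assumes clV: "closed V" and subV: "subspace V"
begin

lemma rproj_characterization:
  "rproj V x = y \<longleftrightarrow> y \<in> V \<and> (\<forall>v\<in>V. rinner (x - y) v = 0)"
proof -
  define p where "p x = (SOME y. y \<in> V \<and> (\<forall>v\<in>V. rinner (x - y) v = 0))" for x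
  have ex: "\<exists>y. y \<in> V \<and> (\<forall>v\<in>V. rinner (x - y) v = 0)" for x
    using orthogonal_projection_exists[OF clV subV, of x] by metis
  have p: "p x \<in> V" "\<And>v. v \<in> V \<Longrightarrow> rinner (x - p x) v = 0" for x
    using someI_ex[OF ex[of x]] unfolding p_def by auto
  have uniq: "p x = y" if "y \<in> V" "\<And>v. v \<in> V \<Longrightarrow> rinner (x - y) v = 0" for x y
  proof -
    have "p x - y \<in> V" using p(1) that(1) subV by (simp add: subspace_diff)
    hence "rinner (x - y) (p x - y) - rinner (x - p x) (p x - y) = 0" using p that by simp
    moreover have "rinner (x - y) (p x - y) - rinner (x - p x) (p x - y) = (norm (p x - y))\<^sup>2"
      by (simp add: rinner_self[symmetric] rinner_simps)
    ultimately show ?thesis by simp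
  qed
  have "bounded_linear p"
  proof (rule bounded_linear_intro[where K = 1])
    show "p (x + y) = p x + p y" for x y
    proof (rule uniq)
      show "p x + p y \<in> V" using p subV by (simp add: subspace_add)
      show "rinner (x + y - (p x + p y)) v = 0" if "v \<in> V" for v
        using p(2)[OF that, of x] p(2)[OF that, of y] by (simp add: rinner_simps)
    qed
    show "p (r *\<^sub>R x) = r *\<^sub>R p x" for r x
    proof (rule uniq)
      show "r *\<^sub>R p x \<in> V" using p subV by (simp add: subspace_scale)
      show "rinner (r *\<^sub>R x - r *\<^sub>R p x) v = 0" if "v \<in> V" for v
        using p(2)[OF that, of x] by (simp add: rinner_simps)
    qed
    show "norm (p x) \<le> norm x * 1" for x
    proof -
      have "rinner x (p x) - (norm (p x))\<^sup>2 = 0"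
        using p(2)[OF p(1), of x x] by (simp add: rinner_self[symmetric] rinner_simps)
      hence "norm (p x) * norm (p x) \<le> norm x * norm (p x)"
        using rinner_le_norm[of x "p x"] by (simp add: power2_eq_square)
      thus ?thesis by (cases "p x = 0") auto
    qed
  qed
  hence "rproj V x = p x" unfolding rproj_def p_def by (simp add: bounded_linear_Blinfun_apply)
  thus ?thesis using p uniq by metis
qed

lemma rproj_in: "rproj V x \<in> V"
  using rproj_characterization by blast

lemma rproj_orth: "v \<in> V \<Longrightarrow> rinner (x - rproj V x) v = 0"
  using rproj_characterization by blast

lemma rproj_id: "v \<in> V \<Longrightarrow> rproj V v = v"
  by (simp add: rproj_characterization rinner_simps)

lemma rproj_idem [simp]: "rproj V (rproj V x) = rproj V x"
  by (simp add: rproj_id rproj_in)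

lemma rinner_rproj_self: "rinner x (rproj V x) = (norm (rproj V x))\<^sup>2"
  using rproj_orth[OF rproj_in, of x x] by (simp add: rinner_self[symmetric] rinner_simps)

lemma rproj_selfadjoint: "rinner (rproj V x) y = rinner x (rproj V y)"
  using rproj_orth[OF rproj_in, of x y] rproj_orth[OF rproj_in, of y x]
  by (simp add: rinner_simps rinner_commute)

lemma rproj_eq_0_iff: "rproj V x = 0 \<longleftrightarrow> (\<forall>v\<in>V. rinner x v = 0)"
  using subspace_0[OF subV] by (simp add: rproj_characterization)

lemma norm_rproj: "norm (rproj V) \<le> 1"
proof (rule norm_blinfun_bound)
  fix x
  have "norm (rproj V x) * norm (rproj V x) \<le> norm x * norm (rproj V x)"
    using rinner_rproj_self[of x] rinner_le_norm[of x "rproj V x"] by (simp add: power2_eq_square)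
  thus "norm (rproj V x) \<le> 1 * norm x" by (cases "rproj V x = 0") auto
qed simp

lemma norm_compl_rproj: "norm (id_blinfun - rproj V) \<le> 1"
proof (rule norm_blinfun_bound)
  fix x
  have "(norm (x - rproj V x))\<^sup>2 = (norm x)\<^sup>2 - (norm (rproj V x))\<^sup>2"
    using rinner_rproj_self[of x]
    by (simp add: rinner_self[symmetric] rinner_simps rinner_commute)
  hence "(norm (x - rproj V x))\<^sup>2 \<le> (norm x)\<^sup>2" by simp
  thus "norm ((id_blinfun - rproj V) x) \<le> 1 * norm x"
    using power2_le_imp_le[OF _ norm_ge_zero] by (simp add: blinfun.bilinear_simps)
qed simp

end

text \<open>
  The projection onto \<open>g V\<close> is the conjugate of the projection onto \<open>V\<close>. It is used for multiplication
  by \<open>\<i>\<close>, which relates the projections onto \<open>V\<close> and \<open>iV\<close>, and for unitary operators.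
\<close>

lemma rproj_isometry_image:
  fixes g :: "'a::complex_hilbert_space \<Rightarrow>\<^sub>L 'a"
  assumes "closed V" "subspace V" "closed (g ` V)"
    and iso: "\<And>x y. rinner (g x) (g y) = rinner x y"
  shows "rproj (g ` V) (g x) = g (rproj V x)"
proof -
  have "subspace (g ` V)"
    using assms(2) blinfun.bounded_linear_right bounded_linear.linear linear_subspace_image by blast
  thus ?thesis
    using assms by (subst rproj_characterization)
      (auto simp: rproj_in rproj_orth blinfun.diff_right[symmetric] iso)
qed

lemma subspace_closure:
  fixes S :: "'a::real_normed_vector set"
  assumes "subspace S"
  shows "subspace (closure S)"
proof (rule subspaceI)
  show "0 \<in> closure S" using subspace_0[OF assms] closure_subset by blast
  show "x + y \<in> closure S" if xy: "x \<in> closure S" "y \<in> closure S" for x y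
  proof -
    obtain f h where "\<forall>n. f n \<in> S" "f \<longlonglongrightarrow> x" "\<forall>n. h n \<in> S" "h \<longlonglongrightarrow> y"
      using xy unfolding closure_sequential by blast
    hence "\<forall>n. f n + h n \<in> S" "(\<lambda>n. f n + h n) \<longlonglongrightarrow> x + y"
      using assms by (auto simp: subspace_add intro: tendsto_add)
    thus ?thesis unfolding closure_sequential by (intro exI conjI)
  qed
  show "r *\<^sub>R x \<in> closure S" if x: "x \<in> closure S" for r x
  proof -
    obtain f where "\<forall>n. f n \<in> S" "f \<longlonglongrightarrow> x"
      using x unfolding closure_sequential by blast
    hence "\<forall>n. r *\<^sub>R f n \<in> S" "(\<lambda>n. r *\<^sub>R f n) \<longlonglongrightarrow> r *\<^sub>R x"
      using assms by (auto simp: subspace_scale intro: tendsto_intros)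
    thus ?thesis unfolding closure_sequential by (intro exI conjI)
  qed
qed

text \<open>
  A vector orthogonal to the range of \<open>M\<close> lies in the kernel of \<open>M\<close>.
\<close>

lemma dense_range_selfadjoint_injective:
  fixes M :: "'a::complex_hilbert_space \<Rightarrow>\<^sub>L 'a"
  assumes sa: "\<And>x y. rinner (M x) y = rinner x (M y)" and inj: "\<And>x. M x = 0 \<Longrightarrow> x = 0"
  shows "closure (range M) = UNIV"
proof -
  have "subspace (range M)"
    by (metis blinfun.bounded_linear_right bounded_linear.linear linear_subspace_image subspace_UNIV)
  hence sub: "subspace (closure (range M))" by (rule subspace_closure)
  have "x \<in> closure (range M)" for x
  proof -
    define z where "z = x - rproj (closure (range M)) x"
    have "rinner (M z) w = 0" for w
    proof -
      have "M w \<in> closure (range M)" by (rule subsetD[OF closure_subset]) simp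
      thus ?thesis unfolding sa z_def by (rule rproj_orth[OF closed_closure sub])
    qed
    hence "M z = 0" by (rule rinner_eq_0_all)
    hence "z = 0" by (rule inj)
    thus ?thesis using rproj_in[OF closed_closure sub, of x] by (simp add: z_def)
  qed
  thus ?thesis by blast
qed

lemma blinfun_eq_on_dense:
  fixes F G :: "'a::real_normed_vector \<Rightarrow>\<^sub>L 'b::real_normed_vector"
  assumes "closure (range M) = UNIV" "\<And>x. F (M x) = G (M x)"
  shows "F = G"
proof (rule blinfun_eqI)
  fix x
  obtain f where f: "\<And>n. f n \<in> range M" "f \<longlonglongrightarrow> x"
    using assms(1) closure_sequential[of x "range M"] by auto
  have "F (f n) = G (f n)" for n using f(1)[of n] assms(2) by auto
  moreover have "(\<lambda>n. F (f n)) \<longlonglongrightarrow> F x" "(\<lambda>n. G (f n)) \<longlonglongrightarrow> G x"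
    by (intro tendsto_intros f(2))+
  ultimately show "F x = G x" using LIMSEQ_unique by auto
qed

text \<open>
  The closure of \<open>{(M x, K x)}\<close> is a linear relation that preserves norms, hence single-valued, and it
  is defined everywhere by completeness.
\<close>

lemma factor_through_dense_range:
  fixes M :: "'a::real_normed_vector \<Rightarrow>\<^sub>L 'b::real_normed_vector"
    and K :: "'a \<Rightarrow>\<^sub>L 'c::banach"
  assumes dense: "closure (range M) = UNIV" and norm_eq: "\<And>x. norm (K x) = norm (M x)"
  obtains J :: "'b \<Rightarrow>\<^sub>L 'c" where "\<And>x. J (M x) = K x" "\<And>y. norm (J y) = norm y"
proof -
  define G where "G = closure (range (\<lambda>x. (M x, K x)))"
  have "subspace (range (\<lambda>x. (M x, K x)))"
    by (rule linear_subspace_image[OF _ subspace_UNIV])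
      (auto simp: linear_iff blinfun.bilinear_simps)
  hence sub: "subspace G" unfolding G_def by (rule subspace_closure)
  have norm_G: "norm z = norm y" if yz: "(y, z) \<in> G" for y z
  proof -
    obtain f where f: "\<And>n. f n \<in> range (\<lambda>x. (M x, K x))" "f \<longlonglongrightarrow> (y, z)"
      using yz unfolding G_def closure_sequential by auto
    have "norm (snd (f n)) = norm (fst (f n))" for n using f(1)[of n] norm_eq by auto
    moreover have "(\<lambda>n. norm (snd (f n))) \<longlonglongrightarrow> norm z" "(\<lambda>n. norm (fst (f n))) \<longlonglongrightarrow> norm y"
      using tendsto_norm[OF tendsto_snd[OF f(2)]] tendsto_norm[OF tendsto_fst[OF f(2)]] by auto
    ultimately show ?thesis using LIMSEQ_unique by auto
  qed
  have ex: "\<exists>z. (y, z) \<in> G" for y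
  proof -
    obtain f where ran: "\<And>n. f n \<in> range M" and f: "f \<longlonglongrightarrow> y"
      using dense closure_sequential[of y "range M"] by auto
    have "\<exists>x. f n = M x" for n using ran[of n] by blast
    then obtain h where h: "\<And>n. f n = M (h n)" by metis
    have "Cauchy (\<lambda>n. K (h n))"
    proof -
      have "dist (K (h m)) (K (h n)) = dist (f m) (f n)" for m n
        using norm_eq[of "h m - h n"] by (simp add: dist_norm h blinfun.bilinear_simps)
      thus ?thesis using LIMSEQ_imp_Cauchy[OF f] unfolding Cauchy_def by simp
    qed
    then obtain z where z: "(\<lambda>n. K (h n)) \<longlonglongrightarrow> z"
      using Cauchy_convergent convergent_def by blast
    have "(\<lambda>n. (M (h n), K (h n))) \<longlonglongrightarrow> (y, z)"
      using tendsto_Pair[OF f z] by (simp add: h)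
    thus ?thesis unfolding G_def closure_sequential
      by (intro exI[of _ z] exI[of _ "\<lambda>n. (M (h n), K (h n))"]) auto
  qed
  have uniq: "z = z'" if "(y, z) \<in> G" "(y, z') \<in> G" for y z z'
    using norm_G[of 0 "z - z'"] subspace_diff[OF sub that] by simp
  obtain j where j: "\<And>y. (y, j y) \<in> G" using ex by metis
  have "bounded_linear j"
  proof (rule bounded_linear_intro[where K = 1])
    show "j (x + y) = j x + j y" for x y
      using uniq[OF j] subspace_add[OF sub j[of x] j[of y]] by simp
    show "j (r *\<^sub>R x) = r *\<^sub>R j x" for r x
      using uniq[OF j] subspace_scale[OF sub j[of x], of r] by simp
    show "norm (j x) \<le> norm x * 1" for x using norm_G[OF j] by simp
  qed
  hence J: "Blinfun j y = j y" for y by (simp add: bounded_linear_Blinfun_apply)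
  have "(M x, K x) \<in> G" for x unfolding G_def by (rule subsetD[OF closure_subset]) simp
  hence "Blinfun j (M x) = K x" for x using J uniq[OF j] by metis
  moreover have "norm (Blinfun j y) = norm y" for y using J norm_G[OF j] by simp
  ultimately show thesis by (rule that)
qed

lemma op_sqrt_selfadjoint:
  fixes A :: "'a::complex_hilbert_space \<Rightarrow>\<^sub>L 'a"
  assumes "norm (id_blinfun - A) \<le> 1" and sa: "\<And>x y. rinner (A x) y = rinner x (A y)"
  shows "rinner (op_sqrt A x) y = rinner x (op_sqrt A y)"
proof -
  let ?C = "id_blinfun - A"
  have "rinner (sqrt_iter ?C n x) y = rinner x (sqrt_iter ?C n y)" for n x y
    by (induction n arbitrary: x y) (simp_all add: rinner_simps blinfun.bilinear_simps sa)
  moreover have "(\<lambda>n. rinner (sqrt_iter ?C n x) y) \<longlonglongrightarrow> rinner (x - op_sqrt A x) y"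
    "(\<lambda>n. rinner x (sqrt_iter ?C n y)) \<longlonglongrightarrow> rinner x (y - op_sqrt A y)"
    by (intro rinner.tendsto tendsto_const op_sqrt_limit_apply assms)+
  ultimately have "rinner (x - op_sqrt A x) y = rinner x (y - op_sqrt A y)"
    using LIMSEQ_unique by auto
  thus ?thesis by (simp add: rinner_simps)
qed

section \<open>Two real projections and the modular conjugation\<close>

definition ii_op :: "'a::complex_hilbert_space \<Rightarrow>\<^sub>L 'a" where
  "ii_op = Blinfun (\<lambda>x. \<i> *\<^sub>C x)"

lemma ii_op_apply [simp]: "ii_op x = \<i> *\<^sub>C x"
  by (simp add: ii_op_def bounded_linear_Blinfun_apply bounded_linear_ii)

lemma cinner_eqI:
  fixes a b :: "'a::complex_hilbert_space"
  assumes "\<And>x. cinner a x = cinner b x"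
  shows "a = b"
proof -
  have "rinner (a - b) x = 0" for x
    using assms[of x] by (simp add: rinner_simps) (simp add: rinner_def)
  thus ?thesis using rinner_eq_0_all[of "a - b"] by simp
qed

text \<open>
  Operators are treated as real linear ones; complex linearity is commutation with \<open>\<i>\<close>. This lemma
  returns from the real to the complex notion of self-adjointness.
\<close>

lemma complex_selfadjoint:
  fixes A :: "'a::complex_hilbert_space \<Rightarrow>\<^sub>L 'a"
  assumes "\<And>x y. rinner (A x) y = rinner x (A y)" "\<And>x. A (\<i> *\<^sub>C x) = \<i> *\<^sub>C A x"
  shows "cinner (A x) y = cinner x (A y)"
  using assms(1)[of x y] assms(1)[of "\<i> *\<^sub>C x" y] by (simp add: cinner_rinner assms(2))

text \<open>
  The left-hand side is the imaginary part of \<open>cinner x (A x)\<close>.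
\<close>

lemma quadratic_form_real:
  fixes A :: "'a::complex_hilbert_space \<Rightarrow>\<^sub>L 'a"
  assumes "\<And>x y. rinner (A x) y = rinner x (A y)" "\<And>x. A (\<i> *\<^sub>C x) = \<i> *\<^sub>C A x"
  shows "rinner (\<i> *\<^sub>C x) (A x) = 0"
proof -
  have "rinner (\<i> *\<^sub>C x) (A x) = rinner (\<i> *\<^sub>C A x) x"
    using assms(1)[of "\<i> *\<^sub>C x" x] by (simp add: assms(2))
  also have "\<dots> = - rinner (A x) (\<i> *\<^sub>C x)"
    using rinner_ii_ii[of "\<i> *\<^sub>C A x" x] by (simp add: rinner_simps)
  finally show ?thesis by (simp add: rinner_commute)
qed

locale standard_real_subspace =
  fixes V :: "'a::complex_hilbert_space set"
  assumes std: "standard_subspace V"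
begin

lemma closed_V: "closed V" and subspace_V: "subspace V"
  and V_ii_V: "V \<inter> (\<lambda>v. \<i> *\<^sub>C v) ` V = {0}"
  and dense_V: "closure {v + \<i> *\<^sub>C w | v w. v \<in> V \<and> w \<in> V} = UNIV"
  using std by (simp_all add: standard_subspace_def)

abbreviation "iV \<equiv> ii_op ` V"

lemma subspace_iV: "subspace iV"
  by (rule linear_subspace_image[OF bounded_linear.linear subspace_V])
    (rule blinfun.bounded_linear_right)

lemma iV_iff: "x \<in> iV \<longleftrightarrow> \<i> *\<^sub>C x \<in> V"
proof
  show "\<i> *\<^sub>C x \<in> V" if "x \<in> iV"
    using that subspace_V by (auto simp: subspace_neg)
  show "x \<in> iV" if "\<i> *\<^sub>C x \<in> V"
  proof -
    have "x = ii_op (- (\<i> *\<^sub>C x))" by (simp add: ii_simps)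
    moreover have "- (\<i> *\<^sub>C x) \<in> V" using that subspace_V by (simp add: subspace_neg)
    ultimately show ?thesis by blast
  qed
qed

lemma closed_iV: "closed iV"
proof -
  have "iV = ii_op -` V" by (rule set_eqI) (simp only: iV_iff vimage_eq ii_op_apply)
  moreover have "closed (ii_op -` V)"
    by (intro closed_vimage closed_V linear_continuous_on blinfun.bounded_linear_right)
  ultimately show ?thesis by simp
qed

text \<open>
  The letters \<open>c\<close> and \<open>s\<close> recall cosine and sine, because \<open>c\<^sup>2 + s\<^sup>2 = 1\<close>: for two lines in a real plane
  that enclose the angle \<open>\<theta>\<close>, the eigenvalues of \<open>B\<close> are \<open>cos\<^sup>2 (\<theta>/2)\<close> and \<open>sin\<^sup>2 (\<theta>/2)\<close>.
\<close>

definition "P = rproj V"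
definition "Q = rproj iV"
definition "B = (1/2) *\<^sub>R (P + Q)"
definition "K = (1/2) *\<^sub>R (P - Q)"
definition "c = op_sqrt B"
definition "s = op_sqrt (id_blinfun - B)"

lemmas P_facts = rproj_in[OF closed_V subspace_V, folded P_def]
  rproj_id[OF closed_V subspace_V, folded P_def]
  rproj_idem[OF closed_V subspace_V, folded P_def]
  rproj_selfadjoint[OF closed_V subspace_V, folded P_def]
  rproj_eq_0_iff[OF closed_V subspace_V, folded P_def]
  rinner_rproj_self[OF closed_V subspace_V, folded P_def]

lemmas Q_facts = rproj_in[OF closed_iV subspace_iV, folded Q_def]
  rproj_id[OF closed_iV subspace_iV, folded Q_def]
  rproj_idem[OF closed_iV subspace_iV, folded Q_def]
  rproj_selfadjoint[OF closed_iV subspace_iV, folded Q_def]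
  rproj_eq_0_iff[OF closed_iV subspace_iV, folded Q_def]
  rinner_rproj_self[OF closed_iV subspace_iV, folded Q_def]

lemma B_apply: "B x = (1/2) *\<^sub>R (P x + Q x)" and K_apply: "K x = (1/2) *\<^sub>R (P x - Q x)"
  by (simp_all add: B_def K_def blinfun.bilinear_simps)

lemma P_BK: "P x = B x + K x" and Q_BK: "Q x = B x - K x"
  by (simp_all add: B_apply K_apply algebra_simps flip: scaleR_add_left)

lemma Q_ii: "Q (\<i> *\<^sub>C x) = \<i> *\<^sub>C P x"
  using rproj_isometry_image[OF closed_V subspace_V closed_iV, of x] by (simp add: P_def Q_def)

lemma P_ii: "P (\<i> *\<^sub>C x) = \<i> *\<^sub>C Q x"
proof -
  have "Q (\<i> *\<^sub>C (\<i> *\<^sub>C x)) = \<i> *\<^sub>C P (\<i> *\<^sub>C x)" by (rule Q_ii)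
  hence "\<i> *\<^sub>C (- Q x) = - P (\<i> *\<^sub>C x)"
    by (metis scaleC_ii_ii blinfun.minus_right)
  thus ?thesis by (simp add: ii_simps)
qed

lemma B_ii: "B (\<i> *\<^sub>C x) = \<i> *\<^sub>C B x" and K_ii: "K (\<i> *\<^sub>C x) = - (\<i> *\<^sub>C K x)"
  by (simp_all add: B_apply K_apply P_ii Q_ii ii_simps algebra_simps)

lemma B_selfadjoint: "rinner (B x) y = rinner x (B y)"
  and K_selfadjoint: "rinner (K x) y = rinner x (K y)"
  by (simp_all add: B_apply K_apply rinner_simps P_facts Q_facts)

lemma K_B: "K (B x) = K x - B (K x)"
  and K_K: "K (K x) = B x - B (B x)"
  by (simp_all add: B_apply K_apply blinfun.bilinear_simps P_facts Q_facts algebra_simps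
      flip: scaleR_add_left)

lemma norm_B: "norm B \<le> 1"
  using norm_rproj[OF closed_V subspace_V] norm_rproj[OF closed_iV subspace_iV]
    norm_triangle_ineq[of P Q] by (simp add: B_def P_def Q_def)

lemma norm_compl_B: "norm (id_blinfun - B) \<le> 1"
proof -
  have "id_blinfun - B = (1/2) *\<^sub>R ((id_blinfun - P) + (id_blinfun - Q))"
    by (rule blinfun_eqI)
      (simp add: B_apply blinfun.bilinear_simps algebra_simps flip: scaleR_add_left)
  thus ?thesis
    using norm_compl_rproj[OF closed_V subspace_V] norm_compl_rproj[OF closed_iV subspace_iV]
      norm_triangle_ineq[of "id_blinfun - P" "id_blinfun - Q"] by (simp add: P_def Q_def)
qed

lemma norm_compl_compl_B: "norm (id_blinfun - (id_blinfun - B)) \<le> 1"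
  using norm_B by simp

text \<open>
  If \<open>B x = 0\<close>, then \<open>\<parallel>P x\<parallel>\<^sup>2 + \<parallel>Q x\<parallel>\<^sup>2 = 2 \<langle>x, B x\<rangle> = 0\<close>, so \<open>x\<close> is real orthogonal to \<open>V + iV\<close>. This is
  where the density of \<open>V + iV\<close> enters.
\<close>

lemma B_injective: "x = 0" if "B x = 0"
proof -
  have "rinner x (P x) + rinner x (Q x) = 2 * rinner x (B x)"
    by (simp add: B_apply rinner_simps)
  hence "(norm (P x))\<^sup>2 + (norm (Q x))\<^sup>2 = 0"
    using that by (simp add: P_facts Q_facts rinner_simps)
  hence "P x = 0" "Q x = 0" by (simp_all add: add_nonneg_eq_0_iff)
  hence "\<forall>v\<in>V. rinner x v = 0" "\<forall>v\<in>V. rinner x (\<i> *\<^sub>C v) = 0"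
    by (auto simp: P_facts Q_facts)
  hence orth: "rinner x z = 0" if "z \<in> {v + \<i> *\<^sub>C w | v w. v \<in> V \<and> w \<in> V}" for z
    using that by (auto simp: rinner_simps)
  have "x \<in> closure {v + \<i> *\<^sub>C w | v w. v \<in> V \<and> w \<in> V}" using dense_V by simp
  then obtain f where f: "\<forall>n. f n \<in> {v + \<i> *\<^sub>C w | v w. v \<in> V \<and> w \<in> V}" "f \<longlonglongrightarrow> x"
    unfolding closure_sequential by (elim exE conjE)
  have "(\<lambda>n. rinner x (f n)) \<longlonglongrightarrow> rinner x x" by (intro rinner.tendsto tendsto_const f(2))
  moreover have "rinner x (f n) = 0" for n by (rule orth[OF f(1)[rule_format]])
  ultimately have "rinner x x = 0" using LIMSEQ_unique[OF _ tendsto_const] by simp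
  thus ?thesis by (simp add: rinner_self)
qed

text \<open>
  Dually, \<open>B x = x\<close> forces \<open>P x = x = Q x\<close>, and \<open>V \<inter> iV = {0}\<close> applies.
\<close>

lemma compl_B_injective: "x = 0" if "B x = x"
proof -
  have "(norm (x - P x))\<^sup>2 + (norm (x - Q x))\<^sup>2 = 2 * rinner x (x - B x)"
    by (simp add: norm_diff_square P_facts Q_facts rinner_simps B_apply rinner_self)
      (simp add: field_simps)
  hence "(norm (x - P x))\<^sup>2 + (norm (x - Q x))\<^sup>2 = 0" using that by (simp add: rinner_simps)
  hence "P x = x" "Q x = x" by (simp_all add: add_nonneg_eq_0_iff)
  hence "x \<in> V" "x \<in> iV" using P_facts(1) Q_facts(1) by metis+
  thus ?thesis using V_ii_V by auto
qed

lemma c_square: "c (c x) = B x"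
  unfolding c_def by (rule op_sqrt_square[OF norm_compl_B])

lemma s_square: "s (s x) = x - B x"
  unfolding s_def using op_sqrt_square[OF norm_compl_compl_B, of x]
  by (simp add: blinfun.bilinear_simps)

lemma c_selfadjoint: "rinner (c x) y = rinner x (c y)"
  unfolding c_def by (intro op_sqrt_selfadjoint norm_compl_B B_selfadjoint)

lemma s_selfadjoint: "rinner (s x) y = rinner x (s y)"
  unfolding s_def by (intro op_sqrt_selfadjoint norm_compl_compl_B)
    (simp add: rinner_simps blinfun.bilinear_simps B_selfadjoint)

lemma commutes_c:
  fixes D :: "'a \<Rightarrow>\<^sub>L 'a"
  assumes "\<And>x. D (B x) = B (D x)"
  shows "D (c x) = c (D x)"
  unfolding c_def by (intro op_sqrt_intertwines norm_compl_B assms)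

lemma commutes_s:
  fixes D :: "'a \<Rightarrow>\<^sub>L 'a"
  assumes "\<And>x. D (B x) = B (D x)"
  shows "D (s x) = s (D x)"
  unfolding s_def by (intro op_sqrt_intertwines norm_compl_compl_B)
    (simp add: blinfun.bilinear_simps assms)

lemma B_c: "B (c x) = c (B x)"
  by (intro commutes_c refl)

lemma s_c: "s (c x) = c (s x)"
  by (rule commutes_s[symmetric]) (simp add: B_c)

lemma c_ii: "c (\<i> *\<^sub>C x) = \<i> *\<^sub>C c x" and s_ii: "s (\<i> *\<^sub>C x) = \<i> *\<^sub>C s x"
  using commutes_c[of ii_op x] commutes_s[of ii_op x] by (simp_all add: B_ii)

lemma K_c: "K (c x) = s (K x)"
  unfolding c_def s_def by (intro op_sqrt_intertwines norm_compl_B norm_compl_compl_B)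
    (simp add: blinfun.bilinear_simps K_B)

lemma K_s: "K (s x) = c (K x)"
  unfolding c_def s_def by (intro op_sqrt_intertwines norm_compl_B norm_compl_compl_B)
    (simp add: blinfun.bilinear_simps K_B)

lemma c_injective: "x = 0" if "c x = 0"
  using that c_square[of x] B_injective[of x] by (simp add: blinfun.bilinear_simps)

lemma s_injective: "x = 0" if "s x = 0"
  using that s_square[of x] compl_B_injective[of x] by (simp add: blinfun.bilinear_simps)

text \<open>
  \<open>M\<close> is the absolute value of \<open>K\<close>, and \<open>K = J M\<close> is the polar decomposition of this bounded operator.
\<close>

definition "M = c o\<^sub>L s"

lemma M_apply: "M x = c (s x)"
  by (simp add: M_def)

lemma dense_M: "closure (range M) = UNIV"
proof (rule dense_range_selfadjoint_injective)
  show "rinner (M x) y = rinner x (M y)" for x y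
    by (simp add: M_apply c_selfadjoint s_selfadjoint s_c)
  show "x = 0" if "M x = 0" for x
    by (rule s_injective, rule c_injective) (use that in \<open>simp add: M_apply\<close>)
qed

lemma M_square: "M (M x) = B x - B (B x)"
  by (simp add: M_apply s_c c_square s_square blinfun.bilinear_simps)

lemma norm_K_M: "norm (K x) = norm (M x)"
proof -
  have "rinner (K x) (K x) = rinner x (K (K x))" by (rule K_selfadjoint)
  moreover have "rinner (M x) (M x) = rinner x (M (M x))"
    by (simp add: M_apply c_selfadjoint s_selfadjoint s_c)
  ultimately have "(norm (K x))\<^sup>2 = (norm (M x))\<^sup>2" by (simp add: rinner_self K_K M_square)
  thus ?thesis by simp
qed

definition "J = (SOME J :: 'a \<Rightarrow>\<^sub>L 'a. (\<forall>x. J (M x) = K x) \<and> (\<forall>y. norm (J y) = norm y))"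

lemma J_M: "J (M x) = K x" and norm_J: "norm (J y) = norm y"
proof -
  have "\<exists>J :: 'a \<Rightarrow>\<^sub>L 'a. (\<forall>x. J (M x) = K x) \<and> (\<forall>y. norm (J y) = norm y)"
    using factor_through_dense_range[OF dense_M norm_K_M] by metis
  from someI_ex[OF this, folded J_def]
  show "J (M x) = K x" "norm (J y) = norm y" by auto
qed

text \<open>
  The following relations for \<open>J\<close> hold on the dense range of \<open>M\<close>, where they become relations for \<open>K\<close>.
\<close>

lemma J_s: "J (s x) = c (J x)"
proof -
  have "J o\<^sub>L s = c o\<^sub>L J"
  proof (rule blinfun_eq_on_dense[OF dense_M])
    fix x
    have "s (M x) = M (s x)" by (simp add: M_apply s_c)
    thus "(J o\<^sub>L s) (M x) = (c o\<^sub>L J) (M x)" by (simp add: J_M K_s)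
  qed
  thus ?thesis by (metis blinfun_apply_blinfun_compose)
qed

lemma J_c: "J (c x) = s (J x)"
proof -
  have "J o\<^sub>L c = s o\<^sub>L J"
  proof (rule blinfun_eq_on_dense[OF dense_M])
    fix x
    have "c (M x) = M (c x)" by (simp add: M_apply s_c)
    thus "(J o\<^sub>L c) (M x) = (s o\<^sub>L J) (M x)" by (simp add: J_M K_c)
  qed
  thus ?thesis by (metis blinfun_apply_blinfun_compose)
qed

lemma J_K: "J (K x) = M x"
proof -
  have "J o\<^sub>L K = M"
  proof (rule blinfun_eq_on_dense[OF dense_M])
    fix x
    have "K (M x) = M (K x)" by (simp add: M_apply K_c K_s s_c)
    thus "(J o\<^sub>L K) (M x) = M (M x)" by (simp add: J_M K_K M_square)
  qed
  thus ?thesis by (metis blinfun_apply_blinfun_compose)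
qed

lemma J_J: "J (J x) = x"
proof -
  have "J o\<^sub>L J = id_blinfun"
    by (rule blinfun_eq_on_dense[OF dense_M]) (simp add: J_M J_K)
  thus ?thesis by (metis blinfun_apply_blinfun_compose blinfun_apply_id_blinfun)
qed

lemma J_ii: "J (\<i> *\<^sub>C x) = - (\<i> *\<^sub>C J x)"
proof -
  have "J o\<^sub>L ii_op = - (ii_op o\<^sub>L J)"
  proof (rule blinfun_eq_on_dense[OF dense_M])
    fix x
    have "\<i> *\<^sub>C M x = M (\<i> *\<^sub>C x)" by (simp add: M_apply c_ii s_ii)
    thus "(J o\<^sub>L ii_op) (M x) = (- (ii_op o\<^sub>L J)) (M x)"
      by (simp add: J_M K_ii blinfun.bilinear_simps)
  qed
  hence "(J o\<^sub>L ii_op) x = (- (ii_op o\<^sub>L J)) x" by simp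
  thus ?thesis by (simp add: blinfun.bilinear_simps)
qed

lemma rinner_J: "rinner (J x) (J y) = rinner x y"
  using norm_diff_square[of "J x" "J y"] norm_diff_square[of x y]
  by (simp add: blinfun.diff_right[symmetric] norm_J)

lemma antiunitary_J: "antiunitary_op J"
  unfolding antiunitary_op_def
proof (intro conjI allI)
  show "J (a *\<^sub>C x) = cnj a *\<^sub>C J x" for a x
    by (subst (1 2) scaleC_rinner) (simp add: blinfun.bilinear_simps J_ii)
  show "cinner (J x) (J y) = cnj (cinner x y)" for x y
  proof -
    have "rinner (\<i> *\<^sub>C J x) (J y) = - rinner (\<i> *\<^sub>C x) y"
      using rinner_J[of "\<i> *\<^sub>C x" y] by (simp add: J_ii rinner_simps)
    thus ?thesis by (simp add: cinner_rinner rinner_J complex_eq_iff)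
  qed
  show "surj J" by (metis J_J surjI)
qed (simp add: blinfun.bilinear_simps)

section \<open>Polar decomposition of the Tomita operator\<close>

text \<open>
  The graph of \<open>\<Delta>\<^bsup>1/2\<^esup> = s c\<^bsup>-1\<^esup>\<close>. Because \<open>c\<^sup>2 + s\<^sup>2 = 1\<close>, membership is the single
  equation \<open>s x = c y\<close>, from which self-adjointness is immediate.
\<close>

definition "T = range (\<lambda>x. (c x, s x))"

lemma cinner_c: "cinner (c x) y = cinner x (c y)" and cinner_s: "cinner (s x) y = cinner x (s y)"
  by (intro complex_selfadjoint c_selfadjoint s_selfadjoint c_ii s_ii)+

lemma cc_ss: "c (c x) + s (s x) = x"
  by (simp add: c_square s_square)

lemma T_iff: "(x, y) \<in> T \<longleftrightarrow> s x = c y"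
proof
  assume "s x = c y"
  moreover have "c (c x) + s (s x) = x" "c (c y) + s (s y) = y" by (rule cc_ss)+
  \<comment> \<open>\<open>w \<mapsto> (c w, s w)\<close> is isometric, and its adjoint \<open>(x, y) \<mapsto> c x + s y\<close> recovers the parameter\<close>
  ultimately have "x = c (c x + s y)" "y = s (c x + s y)"
    by (simp_all add: blinfun.bilinear_simps s_c)
  thus "(x, y) \<in> T" unfolding T_def by blast
qed (auto simp: T_def s_c)

lemma linear_adjoint_T: "linear_adjoint T = T"
proof -
  have "(y, z) \<in> linear_adjoint T \<longleftrightarrow> (y, z) \<in> T" for y z
  proof -
    have "(y, z) \<in> linear_adjoint T \<longleftrightarrow> (\<forall>x. cinner (s y) x = cinner (c z) x)"
      by (auto simp: linear_adjoint_def T_def cinner_c cinner_s)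
    thus ?thesis unfolding T_iff using cinner_eqI by metis
  qed
  thus ?thesis by auto
qed

text \<open>
  Products of commuting positive operators are positive: take for \<open>F\<close> the product of the square roots
  of \<open>c\<close> and \<open>s\<close>. Injectivity of \<open>F\<close> makes the form strictly positive, which is what the uniqueness of
  the square root of \<open>\<Delta>\<close> rests on.
\<close>

lemma c_s_positive:
  obtains F :: "'a \<Rightarrow>\<^sub>L 'a" where "\<And>x. rinner (c x) (s x) = (norm (F x))\<^sup>2" "\<And>x. F x = 0 \<Longrightarrow> x = 0"
proof -
  define d e where "d = op_sqrt c" and "e = op_sqrt s"
  have nc: "norm (id_blinfun - c) \<le> 1"
    unfolding c_def by (rule op_sqrt_near_id[OF norm_compl_B])
  have ns: "norm (id_blinfun - s) \<le> 1"
    unfolding s_def by (rule op_sqrt_near_id[OF norm_compl_compl_B])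
  have dd: "d (d x) = c x" and ee: "e (e x) = s x" for x
    unfolding d_def e_def by (intro op_sqrt_square nc ns)+
  have d_sa: "rinner (d x) y = rinner x (d y)" and e_sa: "rinner (e x) y = rinner x (e y)" for x y
    unfolding d_def e_def by (intro op_sqrt_selfadjoint nc ns c_selfadjoint s_selfadjoint)+
  have "s (d x) = d (s x)" for x
    unfolding d_def by (intro op_sqrt_intertwines nc s_c)
  hence de: "d (e x) = e (d x)" for x
    unfolding e_def by (intro op_sqrt_intertwines ns) simp
  show thesis
  proof (rule that[of "d o\<^sub>L e"])
    fix x
    have "rinner (c x) (s x) = rinner (d (d x)) (e (e x))" by (simp add: dd ee)
    also have "\<dots> = rinner (e (d x)) (d (e x))" by (simp add: d_sa de e_sa)
    finally show "rinner (c x) (s x) = (norm ((d o\<^sub>L e) x))\<^sup>2" by (simp add: de rinner_self)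
  next
    fix x assume "(d o\<^sub>L e) x = 0"
    hence "d (e (d (e x))) = 0" by simp
    hence "c (s x) = 0" by (simp add: de[symmetric] dd) (simp add: de dd ee)
    thus "x = 0" by (rule s_injective[OF c_injective])
  qed
qed

lemma positive_selfadjoint_T: "positive_selfadjoint T"
  unfolding positive_selfadjoint_def
proof (intro conjI ballI)
  have "range M \<subseteq> Domain T" by (auto simp: T_def M_apply)
  thus "closure (Domain T) = UNIV" using dense_M closure_mono by blast
  show "linear_adjoint T = T" by (rule linear_adjoint_T)
  fix p assume "p \<in> T"
  then obtain x where x: "p = (c x, s x)" by (auto simp: T_def)
  have "cinner (c x) (s x) \<in> \<real>\<^sub>\<ge>\<^sub>0"
  proof -
    obtain F where "rinner (c x) (s x) = (norm (F x :: 'a))\<^sup>2" using c_s_positive by metis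
    moreover have "rinner (\<i> *\<^sub>C c x) (s x) = rinner (\<i> *\<^sub>C x) (M x)"
      using c_selfadjoint[of "\<i> *\<^sub>C x" "s x"] by (simp add: c_ii M_apply)
    moreover have "rinner (\<i> *\<^sub>C x) (M x) = 0"
      by (rule quadratic_form_real) (simp_all add: M_apply c_selfadjoint s_selfadjoint s_c c_ii s_ii)
    ultimately show ?thesis by (simp add: cinner_rinner complex_nonneg_Reals_iff)
  qed
  thus "case p of (x, y) \<Rightarrow> cinner x y \<in> \<real>\<^sub>\<ge>\<^sub>0" by (simp add: x)
qed

text \<open>
  The graph of \<open>\<Delta>\<close>, so that \<open>B\<close> is the resolvent \<open>(1 + \<Delta>)\<^bsup>-1\<^esup>\<close>.
\<close>

definition "A = range (\<lambda>w. (B w, w - B w))"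

lemma T_T: "T O T = A"
proof -
  have "(x, y) \<in> T O T \<longleftrightarrow> (x, y) \<in> A" for x y
  proof
    assume "(x, y) \<in> T O T"
    then obtain z where "(x, z) \<in> T" and zy: "(z, y) \<in> T" by blast
    then obtain u where u: "x = c u" "z = s u" by (auto simp: T_def)
    have "s (s u) = c y" using zy u by (simp add: T_iff)
    hence "u = c (c u + y)" using cc_ss[of u] by (simp add: blinfun.bilinear_simps)
    then obtain w where w: "u = c w" by blast
    have "c (s (s w)) = c y" using \<open>s (s u) = c y\<close> w by (simp add: s_c)
    hence "c (s (s w) - y) = 0" by (simp add: blinfun.bilinear_simps)
    hence "y = s (s w)" using c_injective[of "s (s w) - y"] by simp
    thus "(x, y) \<in> A" using u w by (auto simp: A_def c_square s_square)
  next
    assume "(x, y) \<in> A"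
    then obtain w where "x = c (c w)" "y = s (s w)" by (auto simp: A_def c_square s_square)
    moreover have "(c (c w), c (s w)) \<in> T" "(c (s w), s (s w)) \<in> T" by (simp_all add: T_iff s_c)
    ultimately show "(x, y) \<in> T O T" by blast
  qed
  thus ?thesis by auto
qed

lemma tomita_iff: "(x, y) \<in> tomita_op V \<longleftrightarrow> x + y \<in> V \<and> x - y \<in> iV"
proof
  assume "(x, y) \<in> tomita_op V"
  then obtain v w where "v \<in> V" "w \<in> V" "x = v + \<i> *\<^sub>C w" "y = v - \<i> *\<^sub>C w"
    by (auto simp: tomita_op_def)
  moreover from this have "x + y = 2 *\<^sub>R v" "x - y = ii_op (2 *\<^sub>R w)"
    by (simp_all add: scaleR_2 ii_simps)
  ultimately show "x + y \<in> V \<and> x - y \<in> iV"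
    using subspace_V by (auto simp: subspace_scale)
next
  assume "x + y \<in> V \<and> x - y \<in> iV"
  then obtain w where xy: "x + y \<in> V" and w: "w \<in> V" "x - y = \<i> *\<^sub>C w" by auto
  have "(1/2) *\<^sub>R (x + y) \<in> V" "(1/2) *\<^sub>R w \<in> V"
    using xy w subspace_V by (auto simp: subspace_scale)
  moreover have "x = (1/2) *\<^sub>R (x + y) + \<i> *\<^sub>C (1/2) *\<^sub>R w" "y = (1/2) *\<^sub>R (x + y) - \<i> *\<^sub>C (1/2) *\<^sub>R w"
    using w(2) by (simp_all add: ii_simps flip: w(2)) (simp_all add: algebra_simps flip: scaleR_add_left)
  ultimately show "(x, y) \<in> tomita_op V" unfolding tomita_op_def by blast
qed

lemma antilinear_adjoint_tomita_iff:
  "(y, z) \<in> antilinear_adjoint (tomita_op V) \<longleftrightarrow> P (y - z) = 0 \<and> Q (y + z) = 0"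
proof -
  have eq: "cinner y v = cinner v z \<longleftrightarrow> rinner (y - z) v = 0 \<and> rinner (y + z) (\<i> *\<^sub>C v) = 0" for v
  proof -
    have "rinner (y + z) (\<i> *\<^sub>C v) = - rinner (\<i> *\<^sub>C y) v - rinner (\<i> *\<^sub>C z) v"
      using rinner_ii_ii[of "\<i> *\<^sub>C y" v] rinner_ii_ii[of "\<i> *\<^sub>C z" v] by (simp add: rinner_simps)
    moreover have "cinner v z = cnj (cinner z v)" by (rule cinner_commute)
    ultimately show ?thesis by (auto simp: cinner_rinner rinner_simps complex_eq_iff)
  qed
  have "(y, z) \<in> antilinear_adjoint (tomita_op V) \<longleftrightarrow>
      (\<forall>v\<in>V. \<forall>w\<in>V. cinner y (v - \<i> *\<^sub>C w) = cinner (v + \<i> *\<^sub>C w) z)"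
    by (auto simp: antilinear_adjoint_def tomita_op_def)
  also have "\<dots> \<longleftrightarrow> (\<forall>v\<in>V. cinner y v = cinner v z)"
  proof
    assume *: "\<forall>v\<in>V. \<forall>w\<in>V. cinner y (v - \<i> *\<^sub>C w) = cinner (v + \<i> *\<^sub>C w) z"
    show "\<forall>v\<in>V. cinner y v = cinner v z"
      using * subspace_0[OF subspace_V] by (force simp: ii_simps)
  next
    assume *: "\<forall>v\<in>V. cinner y v = cinner v z"
    have "cinner y (v - \<i> *\<^sub>C w) = cinner y v - \<i> * cinner y w" for v w
      using cinner_add_right[of y "v - \<i> *\<^sub>C w" "\<i> *\<^sub>C w"] by (simp add: cinner_scaleC_right)
    thus "\<forall>v\<in>V. \<forall>w\<in>V. cinner y (v - \<i> *\<^sub>C w) = cinner (v + \<i> *\<^sub>C w) z"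
      using * by (simp add: cinner_add_left cinner_scaleC_left)
  qed
  also have "\<dots> \<longleftrightarrow> (\<forall>v\<in>V. rinner (y - z) v = 0) \<and> (\<forall>v\<in>V. rinner (y + z) (\<i> *\<^sub>C v) = 0)"
    unfolding eq by blast
  also have "\<dots> \<longleftrightarrow> P (y - z) = 0 \<and> Q (y + z) = 0"
    by (auto simp: P_facts(5) Q_facts(5))
  finally show ?thesis .
qed

text \<open>
  For \<open>(x, y)\<close> in the graph of \<open>S\<close> and \<open>(y, z)\<close> in that of its adjoint, \<open>w = x + z\<close> satisfies
  \<open>P w = x + y\<close> and \<open>Q w = x - y\<close>, hence \<open>B w = x\<close>. Conversely \<open>w\<close> yields the intermediate vector \<open>K w\<close>.
\<close>

lemma modular_op_eq: "modular_op V = A"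
proof -
  have "(x, z) \<in> modular_op V \<longleftrightarrow> (x, z) \<in> A" for x z
  proof
    assume "(x, z) \<in> modular_op V"
    then obtain y where y: "x + y \<in> V" "x - y \<in> iV" "P (y - z) = 0" "Q (y + z) = 0"
      unfolding modular_op_def by (auto simp: tomita_iff antilinear_adjoint_tomita_iff)
    have "P (x + z) = P (x + y) - P (y - z)" "Q (x + z) = Q (x - y) + Q (y + z)"
      by (simp_all add: blinfun.bilinear_simps)
    hence "P (x + z) = x + y" "Q (x + z) = x - y" using y by (simp_all add: P_facts Q_facts)
    hence "x = B (x + z)" by (simp add: B_apply flip: scaleR_2)
    moreover from this have "z = (x + z) - B (x + z)" by simp
    ultimately show "(x, z) \<in> A" unfolding A_def by blast
  next
    assume "(x, z) \<in> A"
    then obtain w where w: "x = B w" "z = w - B w" by (auto simp: A_def)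
    have "x + K w = P w" "x - K w = Q w" by (simp_all add: w P_BK Q_BK)
    hence "x + K w \<in> V" "x - K w \<in> iV" using P_facts(1) Q_facts(1) by simp_all
    hence "(x, K w) \<in> tomita_op V" by (simp add: tomita_iff)
    moreover have "K w - z = P w - w" "K w + z = w - Q w" by (simp_all add: w P_BK Q_BK)
    hence "(K w, z) \<in> antilinear_adjoint (tomita_op V)"
      by (simp add: antilinear_adjoint_tomita_iff blinfun.bilinear_simps P_facts Q_facts)
    ultimately show "(x, z) \<in> modular_op V" unfolding modular_op_def by blast
  qed
  thus ?thesis by auto
qed

text \<open>
  Let \<open>T'\<close> be any positive self-adjoint square root of \<open>\<Delta>\<close>. Then \<open>Z = T' B\<close> is everywhere defined, bounded,
  positive, commutes with \<open>B\<close>, and has the square \<open>B (1 - B) = M\<^sup>2\<close>. For \<open>u = Z w - M w\<close> the sum of the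
  nonnegative numbers \<open>\<langle>u, Z u\<rangle>\<close> and \<open>\<langle>u, M u\<rangle>\<close> is \<open>\<langle>u, (Z\<^sup>2 - M\<^sup>2) w\<rangle> = 0\<close>, so \<open>u = 0\<close> by strict positivity
  of \<open>M\<close>. Thus \<open>Z = M\<close>; testing symmetry of \<open>T'\<close> against the pairs \<open>(B w, Z w)\<close> gives \<open>T' \<subseteq> T\<close>, and
  passing to adjoints gives the reverse inclusion.
\<close>

lemma positive_square_root_unique:
  assumes pos: "positive_selfadjoint T'" and sq: "T' O T' = A"
  shows "T' = T"
proof -
  have adj: "linear_adjoint T' = T'" and dense: "closure (Domain T') = UNIV"
    and nonneg: "\<And>x y. (x, y) \<in> T' \<Longrightarrow> 0 \<le> rinner x y"
    using pos unfolding positive_selfadjoint_def by (auto simp: rinner_def complex_nonneg_Reals_iff)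
  have T'_iff: "(y, z) \<in> T' \<longleftrightarrow> (\<forall>(x, x') \<in> T'. cinner y x' = cinner z x)" for y z
    by (subst adj[symmetric]) (simp add: linear_adjoint_def)
  have sym: "cinner y x' = cinner z x" if "(y, z) \<in> T'" "(x, x') \<in> T'" for x x' y z
    using that(1) unfolding T'_iff[of y z] using that(2) by auto
  hence rsym: "rinner y x' = rinner z x" if "(y, z) \<in> T'" "(x, x') \<in> T'" for x x' y z
    using that by (simp add: rinner_def)
  have cinner_diff: "cinner (x - y) z = cinner x z - cinner y z" for x y z :: 'a
    using cinner_add_left[of "x - y" y z] by simp
  have scale_T': "(r *\<^sub>R x, r *\<^sub>R x') \<in> T'" if "(x, x') \<in> T'" for r x x'
    unfolding T'_iff using sym[OF that] by (auto simp: cinner_scaleC_left simp flip: scaleC_of_real)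
  have add_T': "(x + y, x' + y') \<in> T'" if "(x, x') \<in> T'" "(y, y') \<in> T'" for x x' y y'
    unfolding T'_iff using sym[OF that(1)] sym[OF that(2)] by (auto simp: cinner_add_left)
  have diff_T': "(x - y, x' - y') \<in> T'" if "(x, x') \<in> T'" "(y, y') \<in> T'" for x x' y y'
    unfolding T'_iff using sym[OF that(1)] sym[OF that(2)] by (auto simp: cinner_diff)
  \<comment> \<open>\<open>T'\<close> is single-valued because its domain is dense\<close>
  have zero_T': "z = 0" if "(0, z) \<in> T'" for z
  proof -
    have orth: "rinner z x = 0" if "x \<in> Domain T'" for x
      using that rsym[OF \<open>(0, z) \<in> T'\<close>] by (auto simp: rinner_simps)
    have "z \<in> closure (Domain T')" using dense by simp
    then obtain f where f: "\<And>n. f n \<in> Domain T'" "f \<longlonglongrightarrow> z"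
      unfolding closure_sequential by blast
    have "(\<lambda>n. rinner z (f n)) \<longlonglongrightarrow> rinner z z" by (intro rinner.tendsto tendsto_const f)
    hence "rinner z z = 0" using LIMSEQ_unique[OF _ tendsto_const] by (simp add: orth f(1))
    thus ?thesis by (simp add: rinner_self)
  qed
  have uniq: "y = z" if "(x, y) \<in> T'" "(x, z) \<in> T'" for x y z
    using zero_T'[of "y - z"] diff_T'[OF that] by simp
  have "\<exists>z. (B w, z) \<in> T' \<and> (z, w - B w) \<in> T'" for w
    using sq unfolding A_def by blast
  then obtain f where f: "\<And>w. (B w, f w) \<in> T'" "\<And>w. (f w, w - B w) \<in> T'" by metis
  have "bounded_linear f"
  proof (rule bounded_linear_intro[where K = 1])
    show "f (x + y) = f x + f y" for x y
      using uniq[OF f(1)] add_T'[OF f(1)[of x] f(1)[of y]] by (simp add: blinfun.bilinear_simps)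
    show "f (r *\<^sub>R x) = r *\<^sub>R f x" for r x
      using uniq[OF f(1)] scale_T'[OF f(1)[of x], of r] by (simp add: blinfun.bilinear_simps)
    show "norm (f x) \<le> norm x * 1" for x
    proof -
      have "(norm (f x))\<^sup>2 = rinner (B x) (x - B x)"
        using rsym[OF f(1) f(2), of x x] by (simp add: rinner_self)
      also have "\<dots> \<le> norm (B x) * norm (x - B x)" by (rule rinner_le_norm)
      also have "\<dots> \<le> norm x * norm x"
      proof (intro mult_mono)
        show "norm (B x) \<le> norm x"
          using norm_blinfun[of B x] mult_right_mono[OF norm_B, of "norm x"] by simp
        show "norm (x - B x) \<le> norm x"
          using norm_blinfun[of "id_blinfun - B" x] mult_right_mono[OF norm_compl_B, of "norm x"]
          by (simp add: blinfun.bilinear_simps)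
      qed auto
      finally show ?thesis
        by (simp add: power2_eq_square[symmetric])
    qed
  qed
  then obtain Z :: "'a \<Rightarrow>\<^sub>L 'a" where "\<And>w. Z w = f w" using bounded_linear_Blinfun_apply by metis
  hence Z: "(B w, Z w) \<in> T'" "(Z w, w - B w) \<in> T'" for w using f by simp_all
  have Z_sa: "rinner (Z x) y = rinner x (Z y)" for x y
  proof -
    have "rinner (Z x) (y - B y) = rinner (x - B x) (Z y)" by (rule rsym[OF Z(2) Z(2)])
    moreover have "rinner (B x) (Z y) = rinner (Z x) (B y)" by (rule rsym[OF Z(1) Z(1)])
    ultimately show ?thesis by (simp add: rinner_simps)
  qed
  have Z_nonneg: "0 \<le> rinner x (Z x)" for x
    using nonneg[OF Z(1), of x] nonneg[OF Z(2), of x] by (simp add: rinner_simps rinner_commute)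
  have Z_Z: "Z (Z x) = B x - B (B x)" for x
  proof -
    have "rinner (Z (Z x) - (B x - B (B x))) y = 0" for y
    proof -
      have "rinner (B x) (y - B y) = rinner (Z x) (Z y)" by (rule rsym[OF Z(1) Z(2)])
      thus ?thesis by (simp add: rinner_simps Z_sa B_selfadjoint)
    qed
    thus ?thesis using rinner_eq_0_all eq_iff_diff_eq_0 by metis
  qed
  \<comment> \<open>the kernel of \<open>T'\<close> lies in the kernel of \<open>\<Delta>\<close>, which is that of \<open>1 - B\<close>\<close>
  have T'_injective: "x = 0" if "(x, 0) \<in> T'" for x
  proof -
    have "(0, 0) \<in> T'" using diff_T'[OF that that] by simp
    hence "(x, 0) \<in> A" using that sq by blast
    then obtain w where "x = B w" "B w = w" by (auto simp: A_def)
    thus ?thesis using compl_B_injective by simp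
  qed
  \<comment> \<open>both sides have the same image \<open>B (1 - B) x\<close> under \<open>T'\<close>\<close>
  have Z_B: "Z (B x) = B (Z x)" for x
  proof -
    have "(Z (B x), B x - B (B x)) \<in> T'" by (rule Z(2))
    moreover have "(B (Z x), B x - B (B x)) \<in> T'" using Z(1)[of "Z x"] by (simp add: Z_Z)
    ultimately have "(Z (B x) - B (Z x), 0) \<in> T'" using diff_T' by fastforce
    thus ?thesis using T'_injective by fastforce
  qed
  have Z_M: "Z (M x) = M (Z x)" for x
    by (simp add: M_apply commutes_c[of Z, OF Z_B] commutes_s[of Z, OF Z_B])
  have Z_eq: "Z x = M x" for x
  proof -
    define u where "u = Z x - M x"
    obtain F :: "'a \<Rightarrow>\<^sub>L 'a" where F: "\<And>x. rinner (c x) (s x) = (norm (F x))\<^sup>2" "\<And>x. F x = 0 \<Longrightarrow> x = 0"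
      using c_s_positive by blast
    have "Z u + M u = 0" by (simp add: u_def blinfun.bilinear_simps Z_Z Z_M M_square)
    hence "rinner u (Z u) + rinner u (M u) = 0" by (simp flip: rinner.add_right add: rinner_simps)
    moreover have "rinner u (M u) = (norm (F u))\<^sup>2" using F(1)[of u] by (simp add: M_apply c_selfadjoint)
    ultimately have "(norm (F u))\<^sup>2 \<le> 0" using Z_nonneg[of u] by linarith
    hence "u = 0" using F(2) by simp
    thus ?thesis by (simp add: u_def)
  qed
  have sub: "T' \<subseteq> T"
  proof (rule subrelI)
    fix y z assume yz: "(y, z) \<in> T'"
    have "rinner (c (s y - c z)) w = 0" for w
      using rsym[OF yz Z(1)[of w]]
      by (simp add: Z_eq blinfun.bilinear_simps rinner_simps c_square B_selfadjoint M_apply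
          c_selfadjoint s_selfadjoint s_c)
    hence "c (s y - c z) = 0" by (rule rinner_eq_0_all)
    thus "(y, z) \<in> T" using c_injective[of "s y - c z"] by (simp add: T_iff)
  qed
  have "linear_adjoint T \<subseteq> linear_adjoint T'"
    using sub unfolding linear_adjoint_def by fastforce
  thus ?thesis using sub adj linear_adjoint_T by auto
qed

lemma positive_sqrt_modular_op: "positive_sqrt (modular_op V) = T"
  unfolding positive_sqrt_def modular_op_eq
  using positive_selfadjoint_T T_T positive_square_root_unique by (intro the_equality) blast+

text \<open>
  The pair \<open>(x, y)\<close> belongs to the graph of \<open>S\<close> iff \<open>P (x + y) = x + y\<close> and \<open>Q (x - y) = x - y\<close>, where
  \<open>P = B + K\<close> and \<open>Q = B - K\<close>. Adding and subtracting, this says \<open>B x + K y = x\<close> and \<open>B y + K x = y\<close>.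
\<close>

lemma tomita_polar: "tomita_op V = T O {(x, J x) | x. True}"
proof -
  have "(x, y) \<in> tomita_op V \<longleftrightarrow> (\<exists>w. x = c w \<and> y = J (s w))" for x y
  proof
    assume "(x, y) \<in> tomita_op V"
    hence "P (x + y) = x + y" "Q (x - y) = x - y" by (simp_all add: tomita_iff P_facts Q_facts)
    hence eqs: "B x + B y + K x + K y = x + y" "B x - B y - K x + K y = x - y"
      by (simp_all add: P_BK Q_BK blinfun.bilinear_simps algebra_simps)
    have "2 *\<^sub>R (B x + K y) = (B x + B y + K x + K y) + (B x - B y - K x + K y)"
      "2 *\<^sub>R (B y + K x) = (B x + B y + K x + K y) - (B x - B y - K x + K y)"
      by (simp_all add: scaleR_2)
    hence "2 *\<^sub>R (B x + K y) = 2 *\<^sub>R x" "2 *\<^sub>R (B y + K x) = 2 *\<^sub>R y"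
      unfolding eqs by (simp_all add: scaleR_2)
    hence x: "B x + K y = x" and y: "B y + K x = y" by simp_all
    \<comment> \<open>the parameter of \<open>(x, J y)\<close> as a point of the graph \<open>T\<close>\<close>
    define w where "w = c x + s (J y)"
    have "c w = B x + J (M y)"
      by (simp add: w_def blinfun.bilinear_simps c_square M_apply J_c J_s s_c)
    hence "x = c w" by (simp add: J_M x)
    moreover have "J (s w) = J (M x) + B y"
      by (simp add: w_def blinfun.bilinear_simps c_square M_apply J_c J_s s_c J_J)
    hence "y = J (s w)" by (simp add: J_M y add.commute)
    ultimately show "\<exists>w. x = c w \<and> y = J (s w)" by blast
  next
    assume "\<exists>w. x = c w \<and> y = J (s w)"
    then obtain w where w: "x = c w" "y = c (J w)" by (auto simp: J_s)
    have K: "K (c z) = c (J z) - c (B (J z))" for z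
    proof -
      have "K (c z) = J (M (c z))" by (simp add: J_M)
      also have "\<dots> = c (s (s (J z)))" by (simp add: M_apply J_c J_s s_c)
      finally show ?thesis by (simp add: s_square blinfun.bilinear_simps)
    qed
    have "P (x + y) = x + y" "Q (x - y) = x - y"
      by (simp_all add: w P_BK Q_BK blinfun.bilinear_simps K J_J B_c)
    hence "x + y \<in> V" "x - y \<in> iV" by (metis P_facts(1), metis Q_facts(1))
    thus "(x, y) \<in> tomita_op V" by (simp add: tomita_iff)
  qed
  moreover have "(x, y) \<in> T O {(x, J x) | x. True} \<longleftrightarrow> (\<exists>w. x = c w \<and> y = J (s w))" for x y
    unfolding relcomp_unfold T_def by blast
  ultimately show ?thesis by (intro equalityI subrelI) (simp_all only:)
qed

text \<open>
  The antiunitary factor is determined on the range of \<open>s\<close>, because \<open>c\<close> is injective, and then everywhere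
  by continuity.
\<close>

lemma modular_conj_eq: "modular_conj V = J"
  unfolding modular_conj_def positive_sqrt_modular_op
proof (rule the_equality)
  show "antiunitary_op J \<and> tomita_op V = T O {(x, J x) | x. True}"
    using antiunitary_J tomita_polar by blast
  fix J' assume *: "antiunitary_op J' \<and> tomita_op V = T O {(x, J' x) | x. True}"
  have J's: "J' (s x) = J (s x)" for x
  proof -
    have "(c x, J' (s x)) \<in> T O {(x, J x) | x. True}"
      using * tomita_polar by (auto simp: T_def)
    then obtain y where "c x = c y" "J' (s x) = J (s y)" by (auto simp: T_def)
    moreover from this have "c (x - y) = 0" by (simp add: blinfun.bilinear_simps)
    ultimately show ?thesis using c_injective[of "x - y"] by simp
  qed
  have "bounded_linear J'"
  proof (rule bounded_linear_intro[where K = 1])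
    show "J' (x + y) = J' x + J' y" for x y using * by (simp add: antiunitary_op_def)
    show "J' (r *\<^sub>R x) = r *\<^sub>R J' x" for r x
      using * by (simp add: antiunitary_op_def flip: scaleC_of_real)
    show "norm (J' x) \<le> norm x * 1" for x
      using * by (simp add: antiunitary_op_def norm_eq_sqrt_cinner)
  qed
  hence J': "Blinfun J' x = J' x" for x by (simp add: bounded_linear_Blinfun_apply)
  have "Blinfun J' = J"
  proof (rule blinfun_eq_on_dense[OF dense_M])
    fix x
    have "M x = s (c x)" by (simp add: M_apply s_c)
    thus "Blinfun J' (M x) = J (M x)" by (simp add: J' J's)
  qed
  thus "J' = J" using J' by auto
qed

end

section \<open>Modular conjugations and unitary operators\<close>

lemma antiunitary_modular_conj:
  "standard_subspace V \<Longrightarrow> antiunitary_op (modular_conj V)"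
  by (simp add: standard_real_subspace.intro standard_real_subspace.modular_conj_eq
      standard_real_subspace.antiunitary_J)

lemma modular_conj_involution:
  "standard_subspace V \<Longrightarrow> modular_conj V (modular_conj V x) = x"
  by (simp add: standard_real_subspace.intro standard_real_subspace.modular_conj_eq
      standard_real_subspace.J_J)

lemma continuous_on_modular_conj:
  "standard_subspace V \<Longrightarrow> continuous_on S (modular_conj V)"
  by (simp add: standard_real_subspace.intro standard_real_subspace.modular_conj_eq
      linear_continuous_on blinfun.bounded_linear_right)

text \<open>
  The projections of \<open>V\<close> are carried to those of \<open>g V\<close>, hence so are \<open>B\<close> and \<open>K\<close>, hence their square roots
  \<open>c\<close> and \<open>s\<close>, and finally \<open>J\<close>, which is determined by \<open>J c s = K\<close>.
\<close>

lemma modular_conj_unitary_image: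
  assumes "standard_subspace V" "standard_subspace (g ` V)" "unitary_op g"
  shows "modular_conj (g ` V) (g x) = g (modular_conj V x)"
proof -
  interpret V: standard_real_subspace V by (rule standard_real_subspace.intro) fact
  interpret W: standard_real_subspace "g ` V" by (rule standard_real_subspace.intro) fact
  have "bounded_linear g"
  proof (rule bounded_linear_intro[where K = 1])
    show "g (x + y) = g x + g y" for x y using assms(3) by (simp add: unitary_op_def)
    show "g (r *\<^sub>R x) = r *\<^sub>R g x" for r x
      using assms(3) by (simp add: unitary_op_def flip: scaleC_of_real)
    show "norm (g x) \<le> norm x * 1" for x
      using assms(3) by (simp add: unitary_op_def norm_eq_sqrt_cinner)
  qed
  then obtain G where G: "blinfun_apply G = g" using bounded_linear_Blinfun_apply by metis
  have iso: "rinner (G x) (G y) = rinner x y" for x y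
    using assms(3) by (simp add: G rinner_def unitary_op_def)
  have "ii_op (g x) = g (ii_op x)" for x
    using assms(3) by (simp add: unitary_op_def)
  hence iV: "ii_op ` g ` V = g ` ii_op ` V" by (simp add: image_image)
  have P: "W.P (G x) = G (V.P x)" for x
    using rproj_isometry_image[OF V.closed_V V.subspace_V _ iso] W.closed_V
    by (simp add: W.P_def V.P_def G)
  have Q: "W.Q (G x) = G (V.Q x)" for x
    using rproj_isometry_image[OF V.closed_iV V.subspace_iV _ iso] W.closed_iV
    unfolding W.Q_def V.Q_def G iV by blast
  have B: "G (V.B x) = W.B (G x)" and K: "G (V.K x) = W.K (G x)" for x
    by (simp_all add: V.B_apply W.B_apply V.K_apply W.K_apply P Q blinfun.bilinear_simps)
  have c: "G (V.c x) = W.c (G x)" for x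
    unfolding V.c_def W.c_def by (intro op_sqrt_intertwines V.norm_compl_B W.norm_compl_B B)
  have s: "G (V.s x) = W.s (G x)" for x
    unfolding V.s_def W.s_def
    by (intro op_sqrt_intertwines V.norm_compl_compl_B W.norm_compl_compl_B)
      (simp add: blinfun.bilinear_simps B)
  have "W.J o\<^sub>L G = G o\<^sub>L V.J"
  proof (rule blinfun_eq_on_dense[OF V.dense_M])
    fix x
    have "G (V.M x) = W.M (G x)" by (simp add: V.M_apply W.M_apply c s)
    thus "(W.J o\<^sub>L G) (V.M x) = (G o\<^sub>L V.J) (V.M x)" by (simp add: V.J_M W.J_M K)
  qed
  hence "(W.J o\<^sub>L G) x = (G o\<^sub>L V.J) x" by simp
  thus ?thesis by (simp add: V.modular_conj_eq W.modular_conj_eq G)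
qed

lemma unitary_antiunitary_comp:
  assumes "antiunitary_op f" "antiunitary_op g"
  shows "unitary_op (f \<circ> g)"
proof -
  have "surj (f \<circ> g)" using assms unfolding antiunitary_op_def by (intro comp_surj) simp_all
  thus ?thesis using assms by (simp add: antiunitary_op_def unitary_op_def)
qed

section \<open>Geodesics of involutions and one-parameter groups\<close>

text \<open>
  Put \<open>w = j r \<circ> j 0\<close>, with inverse \<open>j 0 \<circ> j r\<close>. Reflecting \<open>(n - 1) r\<close> first in \<open>0\<close> and then in \<open>r\<close> gives
  \<open>j ((n + 1) r) = w \<circ> j ((n - 1) r) \<circ> w\<^bsup>-1\<^esup>\<close>. The claims \<open>j ((n + 1) r) = w \<circ> j (n r)\<close> at \<open>n\<close> and at \<open>n - 1\<close>
  are equivalent: inverting the involutions turns the one into \<open>j (n r) = j ((n - 1) r) \<circ> w\<^bsup>-1\<^esup>\<close>, which the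
  displayed identity relates to the other.
\<close>

lemma reflection_geodesic_int_step:
  fixes j :: "real \<Rightarrow> 'a \<Rightarrow> 'a"
  assumes invol: "\<And>t x. j t (j t x) = x"
    and refl: "\<And>s t x. j (2 * t - s) x = j t (j s (j t x))"
  shows "j (of_int (n + 1) * r) x = j r (j 0 (j (of_int n * r) x))"
proof -
  have step: "j (of_int (n + 1) * r) x = j r (j 0 (j (of_int (n - 1) * r) (j 0 (j r x))))" for n x
  proof -
    have "of_int (n + 1) * r = 2 * r - (2 * 0 - of_int (n - 1) * r)" by (simp add: algebra_simps)
    thus ?thesis by (simp only: refl)
  qed
  show ?thesis
  proof (induction n arbitrary: x rule: int_induct[of _ 0])
    case base
    show ?case by (simp add: invol)
  next
    case (step1 n)
    have "j (of_int (n + 1) * r) (j r (j 0 y)) = j (of_int n * r) y" for y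
    proof -
      have "j (of_int (n + 1) * r) (j (of_int (n + 1) * r) (j (of_int n * r) y))
          = j (of_int (n + 1) * r) (j r (j 0 y))"
        using step1.IH[of "j (of_int n * r) y"] by (simp add: invol)
      thus ?thesis by (simp add: invol)
    qed
    from this[of "j 0 (j r x)"]
    have "j (of_int (n + 1) * r) x = j (of_int n * r) (j 0 (j r x))" by (simp add: invol)
    thus ?case using step[of "n + 1" x] by simp
  next
    case (step2 n)
    have inv': "j (of_int n * r) y = j (of_int (n - 1) * r) (j 0 (j r y))" for y
    proof -
      have "j r (j 0 (j (of_int n * r) y)) = j r (j 0 (j (of_int (n - 1) * r) (j 0 (j r y))))"
        using step2.IH[of y] step[of n y] by simp
      thus ?thesis by (metis invol)
    qed
    show ?case
      using inv'[of "j r (j 0 (j (of_int (n - 1) * r) x))"]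
      by (simp add: invol) (metis invol)
  qed
qed

lemma reflection_geodesic_int_add:
  fixes j :: "real \<Rightarrow> 'a \<Rightarrow> 'a"
  assumes invol: "\<And>t x. j t (j t x) = x"
    and refl: "\<And>s t x. j (2 * t - s) x = j t (j s (j t x))"
  shows "j (of_int m * r + of_int n * r) x = j (of_int m * r) (j 0 (j (of_int n * r) x))"
proof (induction m rule: int_induct[of _ 0])
  case base
  show ?case by (simp add: invol)
next
  case (step1 m)
  have "j (of_int (m + 1) * r + of_int n * r) x = j (of_int ((m + n) + 1) * r) x"
    by (simp add: algebra_simps)
  also have "\<dots> = j r (j 0 (j (of_int (m + n) * r) x))"
    by (rule reflection_geodesic_int_step[OF invol refl])
  also have "\<dots> = j r (j 0 (j (of_int m * r) (j 0 (j (of_int n * r) x))))"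
    using step1.IH by (simp add: algebra_simps)
  also have "\<dots> = j (of_int (m + 1) * r) (j 0 (j (of_int n * r) x))"
    by (rule reflection_geodesic_int_step[OF invol refl, symmetric])
  finally show ?case .
next
  case (step2 m)
  let ?y = "j (of_int (m - 1) * r + of_int n * r) x"
  have "j r (j 0 ?y) = j (of_int ((m + n - 1) + 1) * r) x"
    using reflection_geodesic_int_step[OF invol refl, of "m + n - 1" r x] by (simp add: algebra_simps)
  also have "\<dots> = j (of_int m * r) (j 0 (j (of_int n * r) x))"
    using step2.IH by (simp add: algebra_simps)
  also have "\<dots> = j r (j 0 (j (of_int (m - 1) * r) (j 0 (j (of_int n * r) x))))"
    using reflection_geodesic_int_step[OF invol refl, of "m - 1" r] by simp
  finally show ?case by (metis invol)
qed

lemma continuous_eq_on_rationals: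
  fixes f g :: "real \<Rightarrow> 'a::t2_space"
  assumes "continuous_on UNIV f" "continuous_on UNIV g" and eq: "\<And>q. q \<in> \<rat> \<Longrightarrow> f q = g q"
  shows "f t = g t"
proof -
  have "closed {t. f t = g t}" using assms(1,2) by (rule closed_Collect_eq)
  moreover have "\<rat> \<subseteq> {t. f t = g t}" using eq by blast
  ultimately have "closure \<rat> \<subseteq> {t. f t = g t}" by (intro closure_minimal)
  thus ?thesis using Rats_closure_real by auto
qed

text \<open>
  Two rationals are integer multiples of a common \<open>r\<close>, so the identity holds for them; continuity
  extends it to real \<open>t\<close> for fixed rational \<open>s\<close>, and then to real \<open>s\<close> for fixed \<open>t\<close>.
\<close>

lemma reflection_geodesic_add:
  fixes j :: "real \<Rightarrow> 'a::t2_space \<Rightarrow> 'a"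
  assumes invol: "\<And>t x. j t (j t x) = x"
    and refl: "\<And>s t x. j (2 * t - s) x = j t (j s (j t x))"
    and cont_op: "\<And>t. continuous_on UNIV (j t)"
    and cont: "\<And>x. continuous_on UNIV (\<lambda>t. j t x)"
  shows "j (s + t) x = j s (j 0 (j t x))"
proof -
  have rat: "j (p + q) x = j p (j 0 (j q x))" if pq: "p \<in> \<rat>" "q \<in> \<rat>" for p q x
  proof -
    obtain a b where p: "p = of_int a / of_int b" "b > 0" using pq(1) by (rule Rats_cases') auto
    obtain a' b' where q: "q = of_int a' / of_int b'" "b' > 0" using pq(2) by (rule Rats_cases') auto
    define r :: real where "r = 1 / (of_int b * of_int b')"
    have "p = of_int (a * b') * r" "q = of_int (a' * b) * r"
      using p(2) q(2) by (simp_all add: p(1) q(1) r_def)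
    thus ?thesis using reflection_geodesic_int_add[OF invol refl] by metis
  qed
  have cont_shift: "continuous_on UNIV (\<lambda>t. j (s + t) x)" for s x
    by (rule continuous_on_compose2[OF cont]) (auto intro: continuous_intros)
  have cont_comp: "continuous_on UNIV (\<lambda>t. j s (j 0 (j t x)))" for s x
    by (intro continuous_on_compose2[OF cont_op] continuous_on_compose2[OF cont_op] cont) auto
  have half: "j (p + t) x = j p (j 0 (j t x))" if "p \<in> \<rat>" for p t
    by (rule continuous_eq_on_rationals[OF cont_shift cont_comp rat[OF that]])
  have "continuous_on UNIV (\<lambda>s. j (s + t) x)" using cont_shift[of t x] by (simp add: add.commute)
  thus ?thesis using cont half by (rule continuous_eq_on_rationals)
qed

theorem proposition2p9:
  fixes \<gamma> :: "real \<Rightarrow> 'a::complex_hilbert_space set" and V :: "'a set"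
  assumes "stand_geodesic \<gamma>"
    and "\<gamma> 0 = V"
    and "strongly_continuous (\<lambda>t. modular_conj (\<gamma> t))"
  shows "\<exists>U :: real \<Rightarrow> 'a \<Rightarrow> 'a.
    (unitary_one_parameter_group U \<and> strongly_continuous U \<and>
     (\<forall>t. modular_conj V \<circ> U t \<circ> modular_conj V = U (- t)) \<and>
     (\<forall>t. \<gamma> t = U (t / 2) ` V)) \<and>
    (\<forall>t. modular_conj (\<gamma> t) = U (t / 2) \<circ> modular_conj V \<circ> inv (U (t / 2)) \<and>
         modular_conj (\<gamma> t) = U t \<circ> modular_conj V \<and>
         U t = modular_conj (\<gamma> t) \<circ> modular_conj V) \<and>
    (\<forall>W :: real \<Rightarrow> 'a \<Rightarrow> 'a.
       unitary_one_parameter_group W \<and> strongly_continuous W \<and>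
       (\<forall>t. modular_conj V \<circ> W t \<circ> modular_conj V = W (- t)) \<and>
       (\<forall>t. \<gamma> t = W (t / 2) ` V) \<longrightarrow> W = U) \<and>
    (\<forall>W :: real \<Rightarrow> 'a \<Rightarrow> 'a.
       (\<forall>t. modular_conj (\<gamma> t) = W (t / 2) \<circ> modular_conj V \<circ> inv (W (t / 2)) \<and>
            modular_conj (\<gamma> t) = W t \<circ> modular_conj V) \<longrightarrow> W = U)"
proof -
  define j where "j t = modular_conj (\<gamma> t)" for t
  have jV: "modular_conj V = j 0" by (simp add: j_def assms(2))
  have std: "standard_subspace (\<gamma> t)" for t
    using assms(1) by (simp add: stand_geodesic_def Stand_def)
  have geod: "\<gamma> (2 * t - s) = (j t \<circ> j s) ` \<gamma> s" for s t
    using assms(1) by (simp add: stand_geodesic_def stand_prod_def j_def)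
  have anti: "antiunitary_op (j t)" for t
    unfolding j_def by (rule antiunitary_modular_conj[OF std])
  have invol: "j t (j t x) = x" for t x
    unfolding j_def by (rule modular_conj_involution[OF std])
  have unit: "unitary_op (j t \<circ> j s)" for s t
    by (rule unitary_antiunitary_comp[OF anti anti])
  have refl: "j (2 * t - s) x = j t (j s (j t x))" for s t x
  proof -
    have "modular_conj ((j t \<circ> j s) ` \<gamma> s) ((j t \<circ> j s) y) = (j t \<circ> j s) (modular_conj (\<gamma> s) y)" for y
      using std[of "2 * t - s"] by (intro modular_conj_unitary_image std unit) (simp add: geod)
    hence "j (2 * t - s) (j t (j s y)) = j t y" for y
      unfolding geod[symmetric] j_def[symmetric] by (simp add: invol)
    from this[of "j s (j t x)"] show ?thesis by (simp add: invol)
  qed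
  have cont: "continuous_on UNIV (\<lambda>t. j t x)" for x
    using assms(3) by (simp add: strongly_continuous_def j_def)
  have add: "j (s + t) x = j s (j 0 (j t x))" for s t x
    by (rule reflection_geodesic_add[OF invol refl _ cont])
      (simp add: j_def continuous_on_modular_conj std)
  define U where "U t = j t \<circ> j 0" for t
  have U_add: "U (s + t) = U s \<circ> U t" for s t
    by (simp add: U_def fun_eq_iff add)
  have U_0: "U 0 = id" by (simp add: U_def fun_eq_iff invol)
  have group: "unitary_one_parameter_group U"
    using U_add U_0 unit by (simp add: unitary_one_parameter_group_def U_def)
  have U_cont: "strongly_continuous U"
    using cont by (simp add: strongly_continuous_def U_def)
  have j_neg: "j (- t) x = j 0 (j t (j 0 x))" for t x
    using refl[of 0 t x] by simp
  have U_conj: "j 0 \<circ> U t \<circ> j 0 = U (- t)" for t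
    by (simp add: U_def fun_eq_iff j_neg invol)
  have \<gamma>_U: "\<gamma> t = U (t / 2) ` V" for t
    using geod[of "t / 2" 0] by (simp add: U_def assms(2))
  have inv_U: "inv (U t) = U (- t)" for t
    using U_add[of t "- t"] U_add[of "- t" t] U_0 by (intro inv_unique_comp) simp_all
  have j_U: "j t = U t \<circ> j 0" for t by (simp add: U_def fun_eq_iff invol)
  have j_U_inv: "j t = U (t / 2) \<circ> j 0 \<circ> inv (U (t / 2))" for t
    using add[of "t / 2" "t / 2"] unfolding inv_U by (simp add: U_def fun_eq_iff j_neg invol)
  have uniq: "W = U" if W: "unitary_one_parameter_group W"
      "\<And>t. j 0 \<circ> W t \<circ> j 0 = W (- t)" "\<And>t. \<gamma> t = W (t / 2) ` V" for W
  proof (intro ext)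
    fix t x
    have W_unit: "unitary_op (W u)" and W_add: "W (u + v) y = W u (W v y)" and W_0: "W 0 y = y" for u v y
      using W(1) by (simp_all add: unitary_one_parameter_group_def)
    have W_conj: "j 0 (W (- u) y) = W u (j 0 y)" for u y
      using fun_cong[OF W(2)[of "- u"], of "j 0 y"] by (simp add: invol)
    have "modular_conj (W (t / 2) ` V) (W (t / 2) y) = W (t / 2) (modular_conj V y)" for y
      using std[of t] std[of 0]
      by (intro modular_conj_unitary_image W_unit) (simp_all add: W(3)[symmetric] assms(2))
    hence "j t (W (t / 2) y) = W (t / 2) (j 0 y)" for y
      by (simp add: W(3)[symmetric] jV j_def[symmetric])
    \<comment> \<open>at \<open>y = W\<^bsub>-t/2\<^esub> (j 0 x)\<close>, where \<open>j 0\<close> turns \<open>W\<^bsub>-t/2\<^esub>\<close> into \<open>W\<^bsub>t/2\<^esub>\<close>\<close>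
    from this[of "W (- (t / 2)) (j 0 x)"]
    have "j t (j 0 x) = W (t / 2) (W (t / 2) (j 0 (j 0 x)))"
      using W_conj[of "t / 2" "j 0 x"] W_add[of "t / 2" "- (t / 2)" "j 0 x"] by (simp add: W_0)
    thus "W t x = U t x" using W_add[of "t / 2" "t / 2"] by (simp add: U_def invol)
  qed
  have uniq': "W = U" if "\<And>t. j t = W t \<circ> j 0" for W
  proof (intro ext)
    show "W t x = U t x" for t x using fun_cong[OF that[of t], of "j 0 x"] by (simp add: U_def invol)
  qed
  show ?thesis
    unfolding jV j_def[symmetric]
  proof (intro exI[of _ U] conjI allI impI)
    show "U t = j t \<circ> j 0" for t by (rule U_def)
    show "W = U" if "unitary_one_parameter_group W \<and> strongly_continuous W \<and>
        (\<forall>t. j 0 \<circ> W t \<circ> j 0 = W (- t)) \<and> (\<forall>t. \<gamma> t = W (t / 2) ` V)" for W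
      by (rule uniq) (use that in blast)+
    show "W = U" if "\<forall>t. j t = W (t / 2) \<circ> j 0 \<circ> inv (W (t / 2)) \<and> j t = W t \<circ> j 0" for W
      by (rule uniq') (use that in blast)
  qed (fact group U_cont U_conj \<gamma>_U j_U_inv j_U)+
qed

end
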